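(* Let $k$ be a field, let $\mathrm{MLb}_s(X)$ be the free metabelian Leibniz superalgebra over $k$ generated by a well-ordered set $X=X_0\cup X_1$, let every element of $X$ have degree $1$, and put $$S_1=\{[c_1\cdots c_pa_1a_2]_L-(-1)^{|a_1||a_2|}[c_1\cdots c_pa_2a_1]_L\mid c_1,\dots,c_p,a_1,a_2\in X,\ p\ge2,\ a_2<a_1\},$$ $$S_2=\{[c_1\cdots c_paa]_L\mid a,c_1,\dots,c_p\in X,\ p\ge2,\ |a|=1\},\qquad S'=S_1\cup S_2 .$$ (1) If $\mathrm{char}(k)=2$, then $S_1$ is a Gröbner–Shirshov basis in $\mathrm{Lb}_s(X)$, and the following set forms a linear basis of $\mathrm{MLb}_s(X)$: $$\{[a_1a_2\cdots a_n]_L\mid a_1,\dots,a_n\in X,\ n\ge1,\ a_3\le a_4\le\cdots\le a_n\}.$$ (2) If $\mathrm{char}(k)\neq2$, then $S'$ is a Gröbner–Shirshov basis in $\mathrm{Lb}_s(X)$, and the following set forms a linear basis of $\mathrm{MLb}_s(X)$: $$\{[a_1a_2\cdots a_n]_L\mid a_1,\dots,a_n\in X,\ n\ge1,\ a_3\le\cdots\le a_n;\ \text{for all } j\ge3,\text{ if }|a_j|=1\text{ then }a_j\neq a_{j+1}\}.$$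
   Context: Superalgebras. A superalgebra is a $k$-vector space $\mathcal A=\mathcal A_0\oplus\mathcal A_1$ with a bilinear product $(xy)$ such that $(\mathcal A_i\mathcal A_j)\subseteq\mathcal A_{i+j}$ (indices in $\mathbb Z_2$); $|x|=i$ for $x\in\mathcal A_i$. It is a Leibniz superalgebra if $(x(yz))=((xy)z)-(-1)^{|z||y|}((xz)y)$ for all homogeneous $x,y,z$. It is abelian if all products are zero, and metabelian if it is an extension of an abelian Leibniz superalgebra by another abelian Leibniz superalgebra (equivalently, all products $((xy)(zw))$ vanish). $\mathrm{MLb}_s(X)$ is the free object on $X$ among metabelian Leibniz superalgebras (generators in $X_i$ having parity $i$), i.e. the quotient of $\mathrm{Lb}_s(X)$ by the ideal generated by all $([c_1\cdots c_p]_L[d_1\cdots d_t]_L)$ with $c_i,d_j\in X$, $p,t\ge2$. Free Leibniz superalgebra. $X=X_0\cup X_1$ (disjoint) is a nonempty well-ordered set; $\mathrm{Lb}_s(X)$ is the free Leibniz superalgebra over $k$ on $X$. $[f_1\cdots f_n]_L:=((\cdots((f_1f_2)f_3)\cdots)f_n)$. $\mathrm{NF}(X)=\{[a_1\cdots a_n]_L\mid a_i\in X,\ n\ge 1\}$ is a linear basis of $\mathrm{Lb}_s(X)$; $\ell([a_1\cdots a_n]_L)=\deg([a_1\cdots a_n]_L)=n$. Order: $\mu<\nu$ in $\mathrm{NF}(X)$ iff $(\deg\mu,\ell(\mu),a_1,\dots,a_n)<(\deg\nu,\ell(\nu),b_1,\dots,b_m)$ lexicographically, where $\mu=[a_1\cdots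 a_n]_L$, $\nu=[b_1\cdots b_m]_L$. $\overline f$ is the leading (largest) monomial of $f\neq0$; $f$ is monic if $\overline f$ has coefficient $1$; homogeneous if all its monomials have the same parity. Gröbner–Shirshov bases. Let $S$ be a monic homogeneous set, $s\in S$, $a_1,\dots,a_m\in X$, $m\ge0$. Normal $S$-polynomials are (1) $[sa_1\cdots a_m]_L$, and (2) $[a_1\cdots a_tsa_{t+1}\cdots a_m]_L$ if $\ell(\overline s)=1$, $1\le t\le m$; notation $h_s$. An element is trivial modulo $(S,\mu)$ (resp. $(S,n)$) if it is a linear combination of normal $S$-polynomials with leading monomials $<\mu$ (resp. of degree $\le n$). $S$ is a Gröbner–Shirshov basis in $\mathrm{Lb}_s(X)$ if: for all $f\neq g$ in $S$ with $\overline f=\overline{h_g}$ for a normal $S$-polynomial $h_g$, $f-h_g$ is trivial modulo $(S,\overline f)$; and for all $f\in S$ with $\ell(\overline f)>1$ and $\mu\in\mathrm{NF}(X)$ with $(\mu f)\neq0$, $(\mu f)$ is trivial modulo $(S,\deg\mu+\deg\overline f)$. The condition "$a_j\neq a_{j+1}$" in (2) is imposed for $3\le j<n$. *)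

theory Defs
  imports Complex_Main "HOL-Library.Poly_Mapping" "HOL-Library.Z2"
begin

section \<open>Superalgebras\<close>

definition koszul :: "bit \<Rightarrow> bit \<Rightarrow> 'k::field"
  where "koszul i j = (if i * j = 1 then - 1 else 1)"

definition left_normed :: "('a \<Rightarrow> 'a \<Rightarrow> 'a) \<Rightarrow> 'a list \<Rightarrow> 'a"
  where "left_normed m fs = foldl m (hd fs) (tl fs)"

definition (in vector_space) basis_family :: "('i \<Rightarrow> 'b) \<Rightarrow> 'i set \<Rightarrow> bool"
  where "basis_family e I \<longleftrightarrow> inj_on e I \<and> independent (e ` I) \<and> span (e ` I) = UNIV"

locale nonassoc_algebra = vector_space scale
  for scale :: "'k::field \<Rightarrow> 'a::ab_group_add \<Rightarrow> 'a" +
  fixes mul :: "'a \<Rightarrow> 'a \<Rightarrow> 'a"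
  assumes mul_add_left: "mul (x + y) z = mul x z + mul y z"
    and mul_add_right: "mul x (y + z) = mul x y + mul x z"
    and mul_scale_left: "mul (scale c x) y = scale c (mul x y)"
    and mul_scale_right: "mul x (scale c y) = scale c (mul x y)"
begin

definition ideal :: "'a set \<Rightarrow> bool"
  where "ideal I \<longleftrightarrow> subspace I \<and> (\<forall>x\<in>I. \<forall>y. mul x y \<in> I \<and> mul y x \<in> I)"

definition ideal_gen :: "'a set \<Rightarrow> 'a set"
  where "ideal_gen G = ideal hull G"

lemma ideal_ideal_gen: "ideal (ideal_gen G)"
  unfolding ideal_gen_def
  by (rule hull_in) (auto simp: ideal_def subspace_def)

lemma ideal_gen_superset: "G \<subseteq> ideal_gen G"
  unfolding ideal_gen_def by (rule hull_subset)

lemma ideal_gen_minimal: "G \<subseteq> I \<Longrightarrow> ideal I \<Longrightarrow> ideal_gen G \<subseteq> I"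
  unfolding ideal_gen_def by (rule hull_minimal)

lemma mul_zero_left [simp]: "mul 0 x = 0"
  using mul_scale_left[of 0 0 x] by simp

lemma mul_zero_right [simp]: "mul x 0 = 0"
  using mul_scale_right[of x 0 0] by simp

lemma mul_minus_left: "mul (- x) y = - mul x y"
  using mul_scale_left[of "- 1" x y] by simp

lemma mul_minus_right: "mul x (- y) = - mul x y"
  using mul_scale_right[of x "- 1" y] by simp

lemma mul_diff_left: "mul (x - y) z = mul x z - mul y z"
  using mul_add_left[of x "- y" z] by (simp add: mul_minus_left)

lemma mul_diff_right: "mul x (y - z) = mul x y - mul x z"
  using mul_add_right[of x y "- z"] by (simp add: mul_minus_right)

lemma ideal_mul_diff:
  assumes "ideal I" "x - x' \<in> I" "y - y' \<in> I"
  shows "mul x y - mul x' y' \<in> I"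
proof -
  have "mul x y - mul x' y' = mul (x - x') y + mul x' (y - y')"
    by (simp add: mul_diff_left mul_diff_right)
  then show ?thesis
    using assms by (auto simp: ideal_def intro: subspace_add)
qed

end

locale superalgebra = nonassoc_algebra scale mul
  for scale :: "'k::field \<Rightarrow> 'a::ab_group_add \<Rightarrow> 'a" and mul :: "'a \<Rightarrow> 'a \<Rightarrow> 'a" +
  fixes part :: "bit \<Rightarrow> 'a set"
  assumes subspace_part: "subspace (part i)"
    and part_inter: "part 0 \<inter> part 1 = {0}"
    and part_sum: "\<exists>y\<in>part 0. \<exists>z\<in>part 1. x = y + z"
    and part_mul: "x \<in> part i \<Longrightarrow> y \<in> part j \<Longrightarrow> mul x y \<in> part (i + j)"
begin

text \<open>An ideal generated by homogeneous elements is graded.\<close>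

lemma ideal_gen_graded:
  assumes G: "G \<subseteq> part 0 \<union> part 1"
    and x: "y + z \<in> ideal_gen G" "y \<in> part 0" "z \<in> part 1"
  shows "y \<in> ideal_gen G" "z \<in> ideal_gen G"
proof -
  let ?I = "ideal_gen G"
  let ?J = "{x. \<exists>y\<in>part 0 \<inter> ?I. \<exists>z\<in>part 1 \<inter> ?I. x = y + z}"
  have I: "subspace ?I" "\<And>x y. x \<in> ?I \<Longrightarrow> mul x y \<in> ?I" "\<And>x y. x \<in> ?I \<Longrightarrow> mul y x \<in> ?I"
    using ideal_ideal_gen[of G] by (auto simp: ideal_def)
  have sub: "subspace (part i \<inter> ?I)" for i
    using subspace_part I(1) by (rule subspace_inter)
  have J: "subspace ?J"
    using subspace_sums[OF sub[of 0] sub[of 1]] by (rule back_subst[of subspace]) auto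
  have "ideal ?J"
    unfolding ideal_def
  proof (intro conjI J ballI allI)
    fix x y assume "x \<in> ?J"
    then obtain x0 x1 where x: "x = x0 + x1" "x0 \<in> part 0" "x0 \<in> ?I" "x1 \<in> part 1" "x1 \<in> ?I"
      by blast
    obtain y0 y1 where y: "y = y0 + y1" "y0 \<in> part 0" "y1 \<in> part 1"
      using part_sum by blast
    have p: "mul u v \<in> part (i + j) \<inter> ?I" "mul v u \<in> part (i + j) \<inter> ?I"
      if "u \<in> part i" "u \<in> ?I" "v \<in> part j" for u v i j
      using that I(2,3) part_mul[of u i v j] part_mul[of v j u i] unfolding add.commute[of j i] by blast+
    have "mul x y = (mul x0 y0 + mul x1 y1) + (mul x0 y1 + mul x1 y0)"
      by (simp add: x y mul_add_left mul_add_right)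
    moreover have "mul x0 y0 + mul x1 y1 \<in> part 0 \<inter> ?I"
      using p(1)[of x0 0 y0 0] p(1)[of x1 1 y1 1] x y by (intro subspace_add sub) auto
    moreover have "mul x0 y1 + mul x1 y0 \<in> part 1 \<inter> ?I"
      using p(1)[of x0 0 y1 1] p(1)[of x1 1 y0 0] x y by (intro subspace_add sub) auto
    ultimately show "mul x y \<in> ?J" by blast
    have "mul y x = (mul y0 x0 + mul y1 x1) + (mul y1 x0 + mul y0 x1)"
      by (simp add: x y mul_add_left mul_add_right)
    moreover have "mul y0 x0 + mul y1 x1 \<in> part 0 \<inter> ?I"
      using p(2)[of x0 0 y0 0] p(2)[of x1 1 y1 1] x y by (intro subspace_add sub) auto
    moreover have "mul y1 x0 + mul y0 x1 \<in> part 1 \<inter> ?I"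
      using p(2)[of x0 0 y1 1] p(2)[of x1 1 y0 0] x y by (intro subspace_add sub) auto
    ultimately show "mul y x \<in> ?J" by blast
  qed
  moreover have "G \<subseteq> ?J"
  proof
    fix g assume g: "g \<in> G"
    then have gI: "g \<in> ?I" using ideal_gen_superset by blast
    have z: "0 \<in> part i \<inter> ?I" for i by (rule subspace_0[OF sub])
    from g G consider "g \<in> part 0" | "g \<in> part 1" by blast
    then show "g \<in> ?J"
    proof cases
      case 1
      then have "g = g + 0" "g \<in> part 0 \<inter> ?I" using gI by auto
      then show ?thesis using z[of 1] by blast
    next
      case 2
      then have "g = 0 + g" "g \<in> part 1 \<inter> ?I" using gI by auto
      then show ?thesis using z[of 0] by blast
    qed
  qed
  ultimately have "?I \<subseteq> ?J" by (rule ideal_gen_minimal[rotated])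
  then obtain y' z' where yz: "y + z = y' + z'" "y' \<in> part 0" "y' \<in> ?I" "z' \<in> part 1" "z' \<in> ?I"
    using x(1) by blast
  then have eq: "y - y' = z' - z" by (simp add: algebra_simps)
  have "y - y' \<in> part 0" using x yz by (intro subspace_diff subspace_part)
  moreover have "y - y' \<in> part 1" unfolding eq using x yz by (intro subspace_diff subspace_part)
  ultimately have "y - y' = 0" using part_inter by blast
  then show "y \<in> ?I" "z \<in> ?I" using eq yz by auto
qed

end

locale leibniz_superalgebra = superalgebra +
  assumes leibniz: "x \<in> part h \<Longrightarrow> y \<in> part i \<Longrightarrow> z \<in> part j \<Longrightarrow>
    mul x (mul y z) = mul (mul x y) z - scale (koszul j i) (mul (mul x z) y)"

locale metabelian_leibniz_superalgebra = leibniz_superalgebra +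
  assumes metabelian: "mul (mul x y) (mul z w) = 0"

definition superalgebra_hom ::
    "('k::field \<Rightarrow> 'a::ab_group_add \<Rightarrow> 'a) \<Rightarrow> ('a \<Rightarrow> 'a \<Rightarrow> 'a) \<Rightarrow> (bit \<Rightarrow> 'a set) \<Rightarrow>
     ('k \<Rightarrow> 'b::ab_group_add \<Rightarrow> 'b) \<Rightarrow> ('b \<Rightarrow> 'b \<Rightarrow> 'b) \<Rightarrow> (bit \<Rightarrow> 'b set) \<Rightarrow> ('a \<Rightarrow> 'b) \<Rightarrow> bool"
  where "superalgebra_hom sA mA pA sB mB pB h \<longleftrightarrow>
    (\<forall>x y. h (x + y) = h x + h y) \<and> (\<forall>c x. h (sA c x) = sB c (h x)) \<and>
    (\<forall>x y. h (mA x y) = mB (h x) (h y)) \<and> (\<forall>i. h ` pA i \<subseteq> pB i)"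


section \<open>The free nonassociative superalgebra\<close>

text \<open>A set of generators that is the disjoint union of an even and an odd part is a type
  with a parity function.\<close>

class super_set =
  fixes par :: "'a \<Rightarrow> bit"

datatype 'x magma = Gen 'x | Mul "'x magma" "'x magma"

primrec magma_par :: "'x::super_set magma \<Rightarrow> bit" where
  "magma_par (Gen x) = par x"
| "magma_par (Mul s t) = magma_par s + magma_par t"

type_synonym ('x, 'k) free = "'x magma \<Rightarrow>\<^sub>0 'k"

lift_definition free_scale :: "'k::field \<Rightarrow> ('x, 'k) free \<Rightarrow> ('x, 'k) free"
  is "\<lambda>c f t. c * f t"
  by (rule finite_subset[rotated]) auto

lift_definition free_mul :: "('x, 'k::field) free \<Rightarrow> ('x, 'k) free \<Rightarrow> ('x, 'k) free"
  is "\<lambda>f g t. case t of Gen x \<Rightarrow> 0 | Mul t1 t2 \<Rightarrow> f t1 * g t2"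
proof -
  fix f g :: "'x magma \<Rightarrow> 'k"
  assume *: "finite {t. f t \<noteq> 0}" "finite {t. g t \<noteq> 0}"
  have "{t. (case t of Gen x \<Rightarrow> 0 | Mul t1 t2 \<Rightarrow> f t1 * g t2) \<noteq> 0}
      \<subseteq> case_prod Mul ` ({t. f t \<noteq> 0} \<times> {t. g t \<noteq> 0})"
  proof
    fix t assume "t \<in> {t. (case t of Gen x \<Rightarrow> 0 | Mul t1 t2 \<Rightarrow> f t1 * g t2) \<noteq> 0}"
    then show "t \<in> case_prod Mul ` ({t. f t \<noteq> 0} \<times> {t. g t \<noteq> 0})"
      by (cases t) auto
  qed
  then show "finite {t. (case t of Gen x \<Rightarrow> 0 | Mul t1 t2 \<Rightarrow> f t1 * g t2) \<noteq> 0}"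
    using * by (meson finite_SigmaI finite_imageI finite_subset)
qed

definition free_part :: "bit \<Rightarrow> ('x::super_set, 'k::field) free set"
  where "free_part i = {f. \<forall>t\<in>Poly_Mapping.keys f. magma_par t = i}"

lift_definition free_proj :: "bit \<Rightarrow> ('x::super_set, 'k::field) free \<Rightarrow> ('x, 'k) free"
  is "\<lambda>i f t. if magma_par t = i then f t else 0"
  by (rule finite_subset[rotated]) auto

lemma free_part_iff: "f \<in> free_part i \<longleftrightarrow> (\<forall>t. magma_par t \<noteq> i \<longrightarrow> Poly_Mapping.lookup f t = 0)"
  by (auto simp: free_part_def in_keys_iff)

interpretation free: superalgebra free_scale free_mul free_part
proof
  fix x y z :: "('x::super_set, 'k::field) free" and a b :: 'k and i j :: bit
  show "free_scale a (x + y) = free_scale a x + free_scale a y"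
    by transfer (simp add: fun_eq_iff algebra_simps)
  show "free_scale (a + b) x = free_scale a x + free_scale b x"
    by transfer (simp add: fun_eq_iff algebra_simps)
  show "free_scale a (free_scale b x) = free_scale (a * b) x"
    by transfer (simp add: fun_eq_iff algebra_simps)
  show "free_scale 1 x = x"
    by transfer simp
  show "free_mul (x + y) z = free_mul x z + free_mul y z"
    by transfer (auto simp: fun_eq_iff algebra_simps split: magma.split)
  show "free_mul x (y + z) = free_mul x y + free_mul x z"
    by transfer (auto simp: fun_eq_iff algebra_simps split: magma.split)
  show "free_mul (free_scale a x) y = free_scale a (free_mul x y)"
    by transfer (auto simp: fun_eq_iff algebra_simps split: magma.split)
  show "free_mul x (free_scale a y) = free_scale a (free_mul x y)"
    by transfer (auto simp: fun_eq_iff algebra_simps split: magma.split)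
next
  fix x y :: "('x::super_set, 'k::field) free" and i j :: bit and t :: "'x magma"
  have sc: "module (free_scale :: 'k \<Rightarrow> ('x, 'k) free \<Rightarrow> _)"
    by unfold_locales (transfer; simp add: fun_eq_iff algebra_simps)+
  show "module.subspace free_scale (free_part i :: ('x, 'k) free set)"
    by (auto simp: module.subspace_def[OF sc] free_part_iff lookup_add free_scale.rep_eq)
  show "free_part 0 \<inter> free_part 1 = {0 :: ('x, 'k) free}"
  proof -
    have "f = 0" if "f \<in> free_part 0 \<inter> free_part 1" for f :: "('x, 'k) free"
    proof (rule poly_mapping_eqI)
      fix t
      show "Poly_Mapping.lookup f t = Poly_Mapping.lookup 0 t"
        using that by (cases "magma_par t = 0") (auto simp: free_part_iff)
    qed
    then show ?thesis by (auto simp: free_part_iff)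
  qed
  show "\<exists>y\<in>free_part 0. \<exists>z\<in>free_part 1. x = y + z"
  proof (intro bexI)
    show "x = free_proj 0 x + free_proj 1 x"
    proof (rule poly_mapping_eqI)
      fix t
      show "Poly_Mapping.lookup x t = Poly_Mapping.lookup (free_proj 0 x + free_proj 1 x) t"
        by (cases "magma_par t") (auto simp: lookup_add free_proj.rep_eq)
    qed
  qed (auto simp: free_part_iff free_proj.rep_eq)
  show "free_mul x y \<in> free_part (i + j)" if "x \<in> free_part i" "y \<in> free_part j"
    unfolding free_part_iff
  proof (intro allI impI)
    fix t :: "'x magma" assume "magma_par t \<noteq> i + j"
    then show "Poly_Mapping.lookup (free_mul x y) t = 0"
      using that by (cases t) (auto simp: free_mul.rep_eq free_part_iff)
  qed
qed


section \<open>The free Leibniz superalgebra\<close>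

definition leibniz_relators :: "('x::super_set, 'k::field) free set"
  where "leibniz_relators =
    {free_mul x (free_mul y z) -
        (free_mul (free_mul x y) z - free_scale (koszul j i) (free_mul (free_mul x z) y))
      | x y z h i j. x \<in> free_part h \<and> y \<in> free_part i \<and> z \<in> free_part j}"

definition leibniz_rel :: "('x::super_set, 'k::field) free \<Rightarrow> ('x, 'k) free \<Rightarrow> bool"
  where "leibniz_rel f g \<longleftrightarrow> f - g \<in> free.ideal_gen leibniz_relators"

lemma (in vector_space) equivp_diff_subspace:
  assumes "subspace I"
  shows "equivp (\<lambda>f g. f - g \<in> I)"
proof (rule equivpI)
  show "reflp (\<lambda>f g. f - g \<in> I)"
    using subspace_0[OF assms] by (simp add: reflp_def)
  show "symp (\<lambda>f g. f - g \<in> I)"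
    proof (rule sympI)
    fix f g assume "f - g \<in> I"
    then show "g - f \<in> I" using subspace_neg[OF assms, of "f - g"] by simp
  qed
  show "transp (\<lambda>f g. f - g \<in> I)"
    proof (rule transpI)
    fix f g h assume "f - g \<in> I" "g - h \<in> I"
    then show "f - h \<in> I" using subspace_add[OF assms, of "f - g" "g - h"] by simp
  qed
qed

lemma (in vector_space) subspace_cong:
  assumes "subspace I" "f - f' \<in> I"
  shows "- f - - f' \<in> I" "g - g' \<in> I \<Longrightarrow> f + g - (f' + g') \<in> I" "g - g' \<in> I \<Longrightarrow> f - g - (f' - g') \<in> I"
    "scale c f - scale c f' \<in> I"
proof -
  show "- f - - f' \<in> I" using subspace_neg[OF assms] by simp
  show "scale c f - scale c f' \<in> I" using subspace_scale[OF assms] by (simp add: scale_right_diff_distrib)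
  assume g: "g - g' \<in> I"
  show "f + g - (f' + g') \<in> I" using subspace_add[OF assms g] by (simp add: algebra_simps)
  show "f - g - (f' - g') \<in> I" using subspace_diff[OF assms g] by (simp add: algebra_simps)
qed

lemma subspace_leibniz: "free.subspace (free.ideal_gen leibniz_relators)"
  using free.ideal_ideal_gen unfolding free.ideal_def by blast

quotient_type (overloaded) ('x, 'k) lb = "('x::super_set, 'k::field) free" / leibniz_rel
  unfolding leibniz_rel_def by (rule free.equivp_diff_subspace[OF subspace_leibniz])

instantiation lb :: (super_set, field) ab_group_add
begin

lift_definition zero_lb :: "('a, 'b) lb" is 0 .

lift_definition plus_lb :: "('a, 'b) lb \<Rightarrow> ('a, 'b) lb \<Rightarrow> ('a, 'b) lb" is "(+)"
  unfolding leibniz_rel_def by (rule free.subspace_cong(2)[OF subspace_leibniz])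

lift_definition uminus_lb :: "('a, 'b) lb \<Rightarrow> ('a, 'b) lb" is uminus
  unfolding leibniz_rel_def by (rule free.subspace_cong(1)[OF subspace_leibniz])

lift_definition minus_lb :: "('a, 'b) lb \<Rightarrow> ('a, 'b) lb \<Rightarrow> ('a, 'b) lb" is "(-)"
  unfolding leibniz_rel_def by (rule free.subspace_cong(3)[OF subspace_leibniz])

instance
  by standard (transfer; simp add: leibniz_rel_def algebra_simps free.subspace_0[OF subspace_leibniz])+

end

lift_definition lb_scale :: "'k::field \<Rightarrow> ('x::super_set, 'k) lb \<Rightarrow> ('x, 'k) lb" is free_scale
  unfolding leibniz_rel_def by (rule free.subspace_cong(4)[OF subspace_leibniz])

lift_definition lb_mul :: "('x::super_set, 'k::field) lb \<Rightarrow> ('x, 'k) lb \<Rightarrow> ('x, 'k) lb" is free_mul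
  unfolding leibniz_rel_def by (rule free.ideal_mul_diff[OF free.ideal_ideal_gen])

lift_definition lb_gen :: "'x::super_set \<Rightarrow> ('x, 'k::field) lb" is "\<lambda>x. Poly_Mapping.single (Gen x) 1" .

definition lb_part :: "bit \<Rightarrow> ('x::super_set, 'k::field) lb set"
  where "lb_part i = abs_lb ` free_part i"

lemma abs_lb_ex: "\<exists>f. x = abs_lb f"
  by (induction x rule: lb.abs_induct) blast

lemma abs_lb_eq_0: "abs_lb f = 0 \<longleftrightarrow> f \<in> free.ideal_gen leibniz_relators"
  by (simp add: zero_lb_def lb.abs_eq_iff leibniz_rel_def)

lemma leibniz_relators_homogeneous:
  "(leibniz_relators :: ('x::super_set, 'k::field) free set) \<subseteq> free_part 0 \<union> free_part 1"
proof
  fix r :: "('x, 'k) free" assume "r \<in> leibniz_relators"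
  then obtain x y z h i j where r: "r = free_mul x (free_mul y z) -
      (free_mul (free_mul x y) z - free_scale (koszul j i) (free_mul (free_mul x z) y))"
    and p: "x \<in> free_part h" "y \<in> free_part i" "z \<in> free_part j"
    unfolding leibniz_relators_def by blast
  have "free_mul x (free_mul y z) \<in> free_part (h + i + j)"
    "free_mul (free_mul x y) z \<in> free_part (h + i + j)"
    "free_mul (free_mul x z) y \<in> free_part (h + i + j)"
    using free.part_mul[OF p(1) free.part_mul[OF p(2,3)]] free.part_mul[OF free.part_mul[OF p(1,2)] p(3)]
      free.part_mul[OF free.part_mul[OF p(1,3)] p(2)]
    by (simp_all only: add.assoc add.commute[of j i])
  then have "r \<in> free_part (h + i + j)"
    unfolding r by (intro free.subspace_diff free.subspace_scale free.subspace_part)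
  then show "r \<in> free_part 0 \<union> free_part 1"
    by (cases "h + i + j") auto
qed

interpretation lb: leibniz_superalgebra lb_scale lb_mul lb_part
proof
  fix x y z :: "('x::super_set, 'k::field) lb" and a b :: 'k
  note * = leibniz_rel_def free.subspace_0[OF subspace_leibniz]
  show "lb_scale a (x + y) = lb_scale a x + lb_scale a y"
    by transfer (simp add: * free.scale_right_distrib)
  show "lb_scale (a + b) x = lb_scale a x + lb_scale b x"
    by transfer (simp add: * free.scale_left_distrib)
  show "lb_scale a (lb_scale b x) = lb_scale (a * b) x"
    by transfer (simp add: *)
  show "lb_scale 1 x = x"
    by transfer (simp add: *)
  show "lb_mul (x + y) z = lb_mul x z + lb_mul y z"
    by transfer (simp add: * free.mul_add_left)
  show "lb_mul x (y + z) = lb_mul x y + lb_mul x z"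
    by transfer (simp add: * free.mul_add_right)
  show "lb_mul (lb_scale a x) y = lb_scale a (lb_mul x y)"
    by transfer (simp add: * free.mul_scale_left)
  show "lb_mul x (lb_scale a y) = lb_scale a (lb_mul x y)"
    by transfer (simp add: * free.mul_scale_right)
next
  fix x y z :: "('x::super_set, 'k::field) lb" and h i j :: bit
  have sc: "module (lb_scale :: 'k \<Rightarrow> ('x, 'k) lb \<Rightarrow> _)"
    by unfold_locales (transfer; simp add: leibniz_rel_def free.subspace_0[OF subspace_leibniz]
        free.scale_right_distrib free.scale_left_distrib)+
  show "module.subspace lb_scale (lb_part i :: ('x, 'k) lb set)"
    unfolding module.subspace_def[OF sc] lb_part_def ball_simps zero_lb_def plus_lb.abs_eq lb_scale.abs_eq
    by (intro conjI ballI allI imageI free.subspace_0 free.subspace_add free.subspace_scale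
        free.subspace_part)
  show "lb_part 0 \<inter> lb_part 1 = {0 :: ('x, 'k) lb}"
  proof -
    have "u = 0" if u: "u \<in> lb_part 0 \<inter> lb_part 1" for u :: "('x, 'k) lb"
    proof -
      from u obtain f g where fg: "u = abs_lb f" "f \<in> free_part 0" "u = abs_lb g" "g \<in> free_part 1"
        unfolding lb_part_def by blast
      then have "leibniz_rel f g" using lb.abs_eq_iff[of f g] by argo
      then have "f + - g \<in> free.ideal_gen leibniz_relators"
        by (simp add: leibniz_rel_def)
      then have "f \<in> free.ideal_gen leibniz_relators"
        by (rule free.ideal_gen_graded(1)[OF leibniz_relators_homogeneous])
          (use fg in \<open>auto intro: free.subspace_neg[OF free.subspace_part]\<close>)
      then show ?thesis by (simp add: fg(1) abs_lb_eq_0)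
    qed
    moreover have "0 \<in> (lb_part i :: ('x, 'k) lb set)" for i
      unfolding lb_part_def zero_lb_def by (intro imageI free.subspace_0 free.subspace_part)
    ultimately show ?thesis by blast
  qed
  show "\<exists>y\<in>lb_part 0. \<exists>z\<in>lb_part 1. x = y + z"
  proof -
    obtain f where abs_lb: "x = abs_lb f" using abs_lb_ex by blast
    then show ?thesis
      using free.part_sum[of f] by (auto simp: lb_part_def plus_lb.abs_eq)
  qed
  show "lb_mul x y \<in> lb_part (i + j)" if "x \<in> lb_part i" "y \<in> lb_part j"
    using that unfolding lb_part_def
    by (elim imageE) (simp only: lb_mul.abs_eq, intro imageI free.part_mul)
  show "lb_mul x (lb_mul y z) = lb_mul (lb_mul x y) z - lb_scale (koszul j i) (lb_mul (lb_mul x z) y)"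
    if "x \<in> lb_part h" "y \<in> lb_part i" "z \<in> lb_part j"
  proof -
    from that obtain f1 f2 f3 where f: "x = abs_lb f1" "y = abs_lb f2" "z = abs_lb f3"
      "f1 \<in> free_part h" "f2 \<in> free_part i" "f3 \<in> free_part j"
      by (auto simp: lb_part_def)
    then have "free_mul f1 (free_mul f2 f3) - (free_mul (free_mul f1 f2) f3
        - free_scale (koszul j i) (free_mul (free_mul f1 f3) f2)) \<in> leibniz_relators"
      unfolding leibniz_relators_def by blast
    then show ?thesis
      using free.ideal_gen_superset
      by (auto simp: f lb_mul.abs_eq lb_scale.abs_eq minus_lb.abs_eq lb.abs_eq_iff leibniz_rel_def)
  qed
qed

abbreviation lb_word :: "'x::super_set list \<Rightarrow> ('x, 'k::field) lb"
  where "lb_word w \<equiv> left_normed lb_mul (map lb_gen w)"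

definition word_par :: "'x::super_set list \<Rightarrow> bit"
  where "word_par w = sum_list (map par w)"

lemma left_normed_snoc: "w \<noteq> [] \<Longrightarrow> left_normed m (w @ [a]) = m (left_normed m w) a"
  by (cases w) (auto simp: left_normed_def)

lemma left_normed_single: "left_normed m [a] = a"
  by (simp add: left_normed_def)

lemma lb_gen_part: "lb_gen x \<in> lb_part (par x)"
  unfolding lb_part_def lb_gen.abs_eq
  by (rule imageI) (auto simp: free_part_iff lookup_single when_def)

lemma lb_word_part:
  "w \<noteq> [] \<Longrightarrow> (lb_word w :: ('x::super_set, 'k::field) lb) \<in> lb_part (word_par w)"
proof (induction w rule: rev_induct)
  case (snoc a w)
  show ?case
  proof (cases "w = []")
    case True
    then show ?thesis using lb_gen_part[of a]
      by (simp only: append_Nil list.map left_normed_single word_par_def sum_list.Cons sum_list.Nil add_0_right)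
  next
    case False
    then have "(lb_mul (lb_word w) (lb_gen a) :: ('x, 'k) lb) \<in> lb_part (word_par w + par a)"
      by (intro lb.part_mul lb_gen_part snoc.IH)
    then show ?thesis using False
      by (simp only: left_normed_snoc map_append list.map word_par_def sum_list_append sum_list.Cons
          sum_list.Nil add_0_right map_is_Nil_conv not_False_eq_True simp_thms)
  qed
qed simp


section \<open>The free metabelian Leibniz superalgebra\<close>

definition metabelian_relators :: "('x::super_set, 'k::field) lb set"
  where "metabelian_relators =
    {lb_mul (lb_word cs) (lb_word ds) | cs ds. length cs \<ge> 2 \<and> length ds \<ge> 2}"

definition metabelian_rel :: "('x::super_set, 'k::field) lb \<Rightarrow> ('x, 'k) lb \<Rightarrow> bool"
  where "metabelian_rel f g \<longleftrightarrow> f - g \<in> lb.ideal_gen metabelian_relators"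

lemma subspace_metabelian: "lb.subspace (lb.ideal_gen metabelian_relators)"
  using lb.ideal_ideal_gen unfolding lb.ideal_def by blast

quotient_type (overloaded) ('x, 'k) mlb = "('x::super_set, 'k::field) lb" / metabelian_rel
  unfolding metabelian_rel_def by (rule lb.equivp_diff_subspace[OF subspace_metabelian])

instantiation mlb :: (super_set, field) ab_group_add
begin

lift_definition zero_mlb :: "('a, 'b) mlb" is 0 .

lift_definition plus_mlb :: "('a, 'b) mlb \<Rightarrow> ('a, 'b) mlb \<Rightarrow> ('a, 'b) mlb" is "(+)"
  unfolding metabelian_rel_def by (rule lb.subspace_cong(2)[OF subspace_metabelian])

lift_definition uminus_mlb :: "('a, 'b) mlb \<Rightarrow> ('a, 'b) mlb" is uminus
  unfolding metabelian_rel_def by (rule lb.subspace_cong(1)[OF subspace_metabelian])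

lift_definition minus_mlb :: "('a, 'b) mlb \<Rightarrow> ('a, 'b) mlb \<Rightarrow> ('a, 'b) mlb" is "(-)"
  unfolding metabelian_rel_def by (rule lb.subspace_cong(3)[OF subspace_metabelian])

instance
  by standard
    (transfer; simp add: metabelian_rel_def algebra_simps lb.subspace_0[OF subspace_metabelian])+

end

lift_definition mlb_scale :: "'k::field \<Rightarrow> ('x::super_set, 'k) mlb \<Rightarrow> ('x, 'k) mlb" is lb_scale
  unfolding metabelian_rel_def by (rule lb.subspace_cong(4)[OF subspace_metabelian])

lift_definition mlb_mul :: "('x::super_set, 'k::field) mlb \<Rightarrow> ('x, 'k) mlb \<Rightarrow> ('x, 'k) mlb" is lb_mul
  unfolding metabelian_rel_def by (rule lb.ideal_mul_diff[OF lb.ideal_ideal_gen])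

lift_definition mlb_gen :: "'x::super_set \<Rightarrow> ('x, 'k::field) mlb" is lb_gen .

definition mlb_part :: "bit \<Rightarrow> ('x::super_set, 'k::field) mlb set"
  where "mlb_part i = abs_mlb ` lb_part i"

abbreviation mlb_word :: "'x::super_set list \<Rightarrow> ('x, 'k::field) mlb"
  where "mlb_word w \<equiv> left_normed mlb_mul (map mlb_gen w)"

lemma abs_mlb_ex: "\<exists>f. x = abs_mlb f"
  by (induction x rule: mlb.abs_induct) blast

lemma abs_mlb_eq_0: "abs_mlb f = 0 \<longleftrightarrow> f \<in> lb.ideal_gen metabelian_relators"
  by (simp add: zero_mlb_def mlb.abs_eq_iff metabelian_rel_def)

lemma metabelian_relators_homogeneous:
  "(metabelian_relators :: ('x::super_set, 'k::field) lb set) \<subseteq> lb_part 0 \<union> lb_part 1"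
proof
  fix r :: "('x, 'k) lb" assume "r \<in> metabelian_relators"
  then obtain cs ds where r: "r = lb_mul (lb_word cs) (lb_word ds)" and "length cs \<ge> 2" "length ds \<ge> 2"
    unfolding metabelian_relators_def by blast
  then have "r \<in> lb_part (word_par cs + word_par ds)"
    unfolding r by (intro lb.part_mul lb_word_part) auto
  then show "r \<in> lb_part 0 \<union> lb_part 1"
    by (cases "word_par cs + word_par ds") auto
qed

subsection \<open>Words span\<close>

lemma (in nonassoc_algebra) mul_span:
  assumes "\<And>a b. a \<in> A \<Longrightarrow> b \<in> B \<Longrightarrow> mul a b \<in> span C" "x \<in> span A" "y \<in> span B"
  shows "mul x y \<in> span C"
proof -
  have *: "mul a y \<in> span C" if "a \<in> A" for a
    using assms(3)
  proof (induction rule: span_induct_alt)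
    case (step c b y)
    then show ?case
      using assms(1)[OF that] by (simp add: mul_add_right mul_scale_right span_add span_scale)
  qed (simp add: span_zero)
  show ?thesis
    using assms(2)
  proof (induction rule: span_induct_alt)
    case (step c a x)
    then show ?case
      using * by (simp add: mul_add_left mul_scale_left span_add span_scale)
  qed (simp add: span_zero)
qed

lemma lb_word_snoc: "w \<noteq> [] \<Longrightarrow> lb_word (w @ [a]) = lb_mul (lb_word w) (lb_gen a)"
  by (simp add: left_normed_snoc)

lemma lb_word_mul:
  "u \<noteq> [] \<Longrightarrow> v \<noteq> [] \<Longrightarrow>
    lb_mul (lb_word u) (lb_word v :: ('x::super_set, 'k::field) lb) \<in> lb.span (lb_word ` {w. length w = length u + length v})"
proof (induction v arbitrary: u rule: rev_induct)
  case (snoc a v)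
  show ?case
  proof (cases "v = []")
    case True
    have "(lb_word (u @ [a]) :: ('x, 'k) lb) \<in> lb.span (lb_word ` {w. length w = length u + 1})"
      by (intro lb.span_base imageI) simp
    then show ?thesis
      unfolding lb_word_snoc[OF snoc.prems(1)] using True by (simp add: left_normed_single)
  next
    case False
    let ?T = "lb.span (lb_word ` {w. length w = length u + length (v @ [a])}) :: ('x, 'k) lb set"
    have eq: "lb_mul (lb_word u) (lb_word (v @ [a]) :: ('x, 'k) lb) =
        lb_mul (lb_mul (lb_word u) (lb_word v)) (lb_gen a)
        - lb_scale (koszul (par a) (word_par v)) (lb_mul (lb_word (u @ [a])) (lb_word v))"
      using lb.leibniz[OF lb_word_part[OF snoc.prems(1)] lb_word_part[OF False] lb_gen_part[of a]]
      by (simp only: lb_word_snoc[OF False] lb_word_snoc[OF snoc.prems(1)])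
    have "lb_mul (lb_mul (lb_word u) (lb_word v)) (lb_gen a) \<in> ?T"
    proof (rule lb.mul_span[OF _ snoc.IH[OF snoc.prems(1) False] lb.span_base[of _ "{lb_gen a}"]])
      fix x b :: "('x, 'k) lb" assume "x \<in> lb_word ` {w. length w = length u + length v}" "b \<in> {lb_gen a}"
      then obtain w where w: "x = lb_word w" "length w = length u + length v" "b = lb_gen a" by blast
      then have "w \<noteq> []" using False by auto
      then have "lb_mul x b = lb_word (w @ [a])" unfolding w(1,3) by (rule lb_word_snoc[symmetric])
      also have "\<dots> \<in> ?T" using w by (intro lb.span_base imageI) simp
      finally show "lb_mul x b \<in> ?T" .
    qed simp
    moreover have "lb_mul (lb_word (u @ [a])) (lb_word v) \<in> ?T"
      using snoc.IH[of "u @ [a]"] False by simp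
    ultimately show ?thesis
      unfolding eq by (intro lb.span_diff lb.span_scale)
  qed
qed simp

lemma free_eq_sum:
  "f = (\<Sum>t\<in>Poly_Mapping.keys f. free_scale (Poly_Mapping.lookup f t) (Poly_Mapping.single t 1))"
  by (rule poly_mapping_eqI)
    (simp add: lookup_sum free_scale.rep_eq lookup_single when_def in_keys_iff
      if_distrib[of "(*) _"] sum.delta' cong: if_cong)

lemma free_mul_single:
  "free_mul (Poly_Mapping.single s a) (Poly_Mapping.single t b) = Poly_Mapping.single (Mul s t) (a * b)"
proof (rule poly_mapping_eqI)
  fix u
  show "Poly_Mapping.lookup (free_mul (Poly_Mapping.single s a) (Poly_Mapping.single t b)) u =
    Poly_Mapping.lookup (Poly_Mapping.single (Mul s t) (a * b)) u"
    by (cases u) (auto simp: free_mul.rep_eq lookup_single when_def)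
qed

primrec eval_magma :: "('a \<Rightarrow> 'a \<Rightarrow> 'a) \<Rightarrow> ('x \<Rightarrow> 'a) \<Rightarrow> 'x magma \<Rightarrow> 'a" where
  "eval_magma m \<phi> (Gen x) = \<phi> x"
| "eval_magma m \<phi> (Mul s t) = m (eval_magma m \<phi> s) (eval_magma m \<phi> t)"

lemma abs_lb_single:
  "abs_lb (Poly_Mapping.single t 1) = (eval_magma lb_mul lb_gen t :: ('x::super_set, 'k::field) lb)"
proof (induction t)
  case (Gen x)
  then show ?case by (simp add: lb_gen.abs_eq)
next
  case (Mul s t)
  have "(abs_lb (Poly_Mapping.single (Mul s t) 1) :: ('x, 'k) lb) =
      lb_mul (abs_lb (Poly_Mapping.single s 1)) (abs_lb (Poly_Mapping.single t 1))"
    by (simp add: lb_mul.abs_eq free_mul_single)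
  then show ?case by (simp add: Mul)
qed

lemma abs_lb_sum: "abs_lb (sum f A) = (\<Sum>a\<in>A. abs_lb (f a))"
  by (induction A rule: infinite_finite_induct) (simp_all add: zero_lb_def plus_lb.abs_eq[symmetric])

lemma abs_lb_eq_sum:
  "abs_lb f = (\<Sum>t\<in>Poly_Mapping.keys f. lb_scale (Poly_Mapping.lookup f t) (eval_magma lb_mul lb_gen t))"
  by (subst free_eq_sum) (simp add: abs_lb_sum lb_scale.abs_eq[symmetric] abs_lb_single)

lemma eval_magma_span_words:
  "(eval_magma lb_mul lb_gen t :: ('x::super_set, 'k::field) lb) \<in> lb.span (lb_word ` {w. w \<noteq> []})"
proof (induction t)
  case (Gen x)
  have "(lb_word [x] :: ('x, 'k) lb) \<in> lb.span (lb_word ` {w. w \<noteq> []})" by (intro lb.span_base imageI) simp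
  then show ?case by (simp add: left_normed_single)
next
  case (Mul s t)
  show ?case
    unfolding eval_magma.simps
  proof (rule lb.mul_span[OF _ Mul])
    fix x y :: "('x, 'k) lb" assume "x \<in> lb_word ` {w. w \<noteq> []}" "y \<in> lb_word ` {w. w \<noteq> []}"
    then obtain u v where uv: "x = lb_word u" "y = lb_word v" "u \<noteq> []" "v \<noteq> []" by blast
    have "lb_mul x y \<in> lb.span (lb_word ` {w. length w = length u + length v})"
      unfolding uv using uv(3,4) by (rule lb_word_mul)
    also have "\<dots> \<subseteq> lb.span (lb_word ` {w. w \<noteq> []})"
      using uv(3) by (intro lb.span_mono image_mono) auto
    finally show "lb_mul x y \<in> lb.span (lb_word ` {w. w \<noteq> []})" .
  qed
qed

lemma span_lb_words: "lb.span (lb_word ` {w. w \<noteq> []}) = (UNIV :: ('x::super_set, 'k::field) lb set)"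
proof -
  have "x \<in> lb.span (lb_word ` {w. w \<noteq> []})" for x :: "('x, 'k) lb"
  proof -
    obtain f where abs_lb: "x = abs_lb f" using abs_lb_ex by blast
    show ?thesis
      unfolding abs_lb abs_lb_eq_sum
      by (intro lb.span_sum lb.span_scale eval_magma_span_words)
  qed
  then show ?thesis by blast
qed

lemma lb_mul_span:
  "lb_mul x (y :: ('x::super_set, 'k::field) lb) \<in> lb.span (lb_word ` {w. length w \<ge> 2})"
proof (rule lb.mul_span)
  show "x \<in> lb.span (lb_word ` {w. w \<noteq> []})" "y \<in> lb.span (lb_word ` {w. w \<noteq> []})"
    by (simp_all add: span_lb_words)
  fix x y :: "('x, 'k) lb" assume "x \<in> lb_word ` {w. w \<noteq> []}" "y \<in> lb_word ` {w. w \<noteq> []}"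
  then obtain u v where uv: "x = lb_word u" "y = lb_word v" "u \<noteq> []" "v \<noteq> []" by blast
  have "lb_mul x y \<in> lb.span (lb_word ` {w. length w = length u + length v})"
    unfolding uv using uv(3,4) by (rule lb_word_mul)
  moreover have "2 \<le> length u + length v"
    using uv(3,4) by (cases u; cases v) auto
  then have "lb.span (lb_word ` {w. length w = length u + length v}) \<subseteq> lb.span (lb_word ` {w. length w \<ge> 2})"
    by (intro lb.span_mono image_mono) auto
  ultimately show "lb_mul x y \<in> lb.span (lb_word ` {w. length w \<ge> 2})" by blast
qed

interpretation mlb: metabelian_leibniz_superalgebra mlb_scale mlb_mul mlb_part
proof
  fix x y z w :: "('x::super_set, 'k::field) mlb" and a b :: 'k
  note * = metabelian_rel_def lb.subspace_0[OF subspace_metabelian]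
  show "mlb_scale a (x + y) = mlb_scale a x + mlb_scale a y"
    by transfer (simp add: * lb.scale_right_distrib)
  show "mlb_scale (a + b) x = mlb_scale a x + mlb_scale b x"
    by transfer (simp add: * lb.scale_left_distrib)
  show "mlb_scale a (mlb_scale b x) = mlb_scale (a * b) x"
    by transfer (simp add: *)
  show "mlb_scale 1 x = x"
    by transfer (simp add: *)
  show "mlb_mul (x + y) z = mlb_mul x z + mlb_mul y z"
    by transfer (simp add: * lb.mul_add_left)
  show "mlb_mul x (y + z) = mlb_mul x y + mlb_mul x z"
    by transfer (simp add: * lb.mul_add_right)
  show "mlb_mul (mlb_scale a x) y = mlb_scale a (mlb_mul x y)"
    by transfer (simp add: * lb.mul_scale_left)
  show "mlb_mul x (mlb_scale a y) = mlb_scale a (mlb_mul x y)"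
    by transfer (simp add: * lb.mul_scale_right)
  show "mlb_mul (mlb_mul x y) (mlb_mul z w) = 0"
  proof transfer
    fix x y z w :: "('x, 'k) lb"
    let ?M = "lb.ideal_gen metabelian_relators :: ('x, 'k) lb set"
    have "lb_mul (lb_mul x y) (lb_mul z w) \<in> lb.span ?M"
    proof (rule lb.mul_span[OF _ lb_mul_span lb_mul_span])
      fix a b :: "('x, 'k) lb"
      assume "a \<in> lb_word ` {w. length w \<ge> 2}" "b \<in> lb_word ` {w. length w \<ge> 2}"
      then have "lb_mul a b \<in> metabelian_relators"
        unfolding metabelian_relators_def by blast
      then show "lb_mul a b \<in> lb.span ?M"
        using lb.ideal_gen_superset lb.span_superset by blast
    qed
    then show "metabelian_rel (lb_mul (lb_mul x y) (lb_mul z w)) 0"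
      unfolding metabelian_rel_def lb.span_eq_iff[THEN iffD2, OF subspace_metabelian] by simp
  qed
next
  fix x y z :: "('x::super_set, 'k::field) mlb" and h i j :: bit
  have sc: "module (mlb_scale :: 'k \<Rightarrow> ('x, 'k) mlb \<Rightarrow> _)"
    by unfold_locales (transfer; simp add: metabelian_rel_def lb.subspace_0[OF subspace_metabelian]
        lb.scale_right_distrib lb.scale_left_distrib)+
  show "module.subspace mlb_scale (mlb_part i :: ('x, 'k) mlb set)"
    unfolding module.subspace_def[OF sc] mlb_part_def ball_simps zero_mlb_def plus_mlb.abs_eq mlb_scale.abs_eq
    by (intro conjI ballI allI imageI lb.subspace_0 lb.subspace_add lb.subspace_scale
        lb.subspace_part)
  show "mlb_part 0 \<inter> mlb_part 1 = {0 :: ('x, 'k) mlb}"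
  proof -
    have "u = 0" if u: "u \<in> mlb_part 0 \<inter> mlb_part 1" for u :: "('x, 'k) mlb"
    proof -
      from u obtain f g where fg: "u = abs_mlb f" "f \<in> lb_part 0" "u = abs_mlb g" "g \<in> lb_part 1"
        unfolding mlb_part_def by blast
      then have "metabelian_rel f g" using mlb.abs_eq_iff[of f g] by argo
      then have "f + - g \<in> lb.ideal_gen metabelian_relators"
        by (simp add: metabelian_rel_def)
      then have "f \<in> lb.ideal_gen metabelian_relators"
        by (rule lb.ideal_gen_graded(1)[OF metabelian_relators_homogeneous])
          (use fg in \<open>auto intro: lb.subspace_neg[OF lb.subspace_part]\<close>)
      then show ?thesis by (simp add: fg(1) abs_mlb_eq_0)
    qed
    moreover have "0 \<in> (mlb_part i :: ('x, 'k) mlb set)" for i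
      unfolding mlb_part_def zero_mlb_def by (intro imageI lb.subspace_0 lb.subspace_part)
    ultimately show ?thesis by blast
  qed
  show "\<exists>y\<in>mlb_part 0. \<exists>z\<in>mlb_part 1. x = y + z"
  proof -
    obtain f where abs_mlb: "x = abs_mlb f" using abs_mlb_ex by blast
    then show ?thesis
      using lb.part_sum[of f] by (auto simp: mlb_part_def plus_mlb.abs_eq)
  qed
  show "mlb_mul x y \<in> mlb_part (i + j)" if "x \<in> mlb_part i" "y \<in> mlb_part j"
    using that unfolding mlb_part_def
    by (elim imageE) (simp only: mlb_mul.abs_eq, intro imageI lb.part_mul)
  show "mlb_mul x (mlb_mul y z) =
      mlb_mul (mlb_mul x y) z - mlb_scale (koszul j i) (mlb_mul (mlb_mul x z) y)"
    if "x \<in> mlb_part h" "y \<in> mlb_part i" "z \<in> mlb_part j"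
    using that by (auto simp: mlb_part_def mlb_mul.abs_eq mlb_scale.abs_eq minus_mlb.abs_eq lb.leibniz)
qed

subsection \<open>Universal properties\<close>

lemma hom_sum:
  assumes "superalgebra_hom sA mA pA sB mB pB h"
  shows "h (sum f A) = (\<Sum>a\<in>A. h (f a))"
proof -
  have "h (0 + 0) = h 0 + h 0" using assms unfolding superalgebra_hom_def by blast
  then have "h 0 = 0" by simp
  then show ?thesis
    using assms by (induction A rule: infinite_finite_induct) (auto simp: superalgebra_hom_def)
qed

theorem lb_universal:
  fixes \<phi> :: "'x::super_set \<Rightarrow> 'b::ab_group_add" and sB :: "'k::field \<Rightarrow> 'b \<Rightarrow> 'b"
  assumes "leibniz_superalgebra sB mB pB" and \<phi>: "\<And>x. \<phi> x \<in> pB (par x)"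
  shows "\<exists>!h. superalgebra_hom lb_scale lb_mul lb_part sB mB pB h \<and> (\<forall>x. h (lb_gen x) = \<phi> x)"
proof -
  interpret B: leibniz_superalgebra sB mB pB by fact
  let ?e = "eval_magma mB \<phi>"
  define E where "E f = (\<Sum>t\<in>Poly_Mapping.keys f. sB (Poly_Mapping.lookup f t) (?e t))"
    for f :: "('x, 'k) free"
  have E_sup: "E f = (\<Sum>t\<in>T. sB (Poly_Mapping.lookup f t) (?e t))"
    if "finite T" "Poly_Mapping.keys f \<subseteq> T" for f T
    unfolding E_def by (rule sum.mono_neutral_left[OF that]) (auto simp: in_keys_iff)
  have E_add: "E (f + g) = E f + E g" for f g
  proof -
    let ?T = "Poly_Mapping.keys f \<union> Poly_Mapping.keys g"
    have "E (f + g) = (\<Sum>t\<in>?T. sB (Poly_Mapping.lookup (f + g) t) (?e t))"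
      by (rule E_sup) (auto simp: in_keys_iff lookup_add)
    also have "\<dots> = (\<Sum>t\<in>?T. sB (Poly_Mapping.lookup f t) (?e t))
        + (\<Sum>t\<in>?T. sB (Poly_Mapping.lookup g t) (?e t))"
      by (simp add: lookup_add B.scale_left_distrib sum.distrib)
    finally show ?thesis by (simp add: E_sup[of ?T f] E_sup[of ?T g])
  qed
  have E_scale: "E (free_scale c f) = sB c (E f)" for c f
  proof -
    have "E (free_scale c f) =
        (\<Sum>t\<in>Poly_Mapping.keys f. sB (Poly_Mapping.lookup (free_scale c f) t) (?e t))"
      by (rule E_sup) (auto simp: in_keys_iff free_scale.rep_eq)
    then show ?thesis by (simp add: E_def free_scale.rep_eq B.scale_sum_right)
  qed
  have E_0: "E 0 = 0" by (simp add: E_def)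
  have E_diff: "E (f - g) = E f - E g" for f g
    using E_add[of "f - g" g] by simp
  have E_single: "E (Poly_Mapping.single t 1) = ?e t" for t
    using E_sup[of "{t}" "Poly_Mapping.single t 1"] by simp
  have E_sum: "E (sum f A) = (\<Sum>a\<in>A. E (f a))" for A :: "'i set" and f
    by (induction A rule: infinite_finite_induct) (auto simp: E_0 E_add)
  have mB_sum_left: "mB (sum f A) y = (\<Sum>a\<in>A. mB (f a) y)" for A :: "'i set" and f y
    by (induction A rule: infinite_finite_induct) (auto simp: B.mul_add_left)
  have mB_sum_right: "mB y (sum f A) = (\<Sum>a\<in>A. mB y (f a))" for A :: "'i set" and f y
    by (induction A rule: infinite_finite_induct) (auto simp: B.mul_add_right)
  have E_mul: "E (free_mul f g) = mB (E f) (E g)" for f g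
  proof -
    have inj: "inj_on (case_prod Mul) (Poly_Mapping.keys f \<times> Poly_Mapping.keys g)"
      by (auto simp: inj_on_def)
    have "E (free_mul f g) = (\<Sum>t\<in>case_prod Mul ` (Poly_Mapping.keys f \<times> Poly_Mapping.keys g).
        sB (Poly_Mapping.lookup (free_mul f g) t) (?e t))"
    proof (rule E_sup)
      show "Poly_Mapping.keys (free_mul f g) \<subseteq> case_prod Mul ` (Poly_Mapping.keys f \<times> Poly_Mapping.keys g)"
      proof
        fix t assume "t \<in> Poly_Mapping.keys (free_mul f g)"
        then show "t \<in> case_prod Mul ` (Poly_Mapping.keys f \<times> Poly_Mapping.keys g)"
          by (cases t) (auto simp: in_keys_iff free_mul.rep_eq)
      qed
    qed simp
    also have "\<dots> = (\<Sum>s\<in>Poly_Mapping.keys f. \<Sum>t\<in>Poly_Mapping.keys g.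
        sB (Poly_Mapping.lookup f s * Poly_Mapping.lookup g t) (mB (?e s) (?e t)))"
      by (subst sum.reindex[OF inj], subst sum.cartesian_product) (auto simp: free_mul.rep_eq intro!: sum.cong)
    also have "\<dots> = mB (E f) (E g)"
      by (simp add: E_def[of f] E_def[of g] mB_sum_left, simp add: mB_sum_right B.mul_scale_left B.mul_scale_right B.scale_sum_right mult.commute)
    finally show ?thesis .
  qed
  have e_part: "?e t \<in> pB (magma_par t)" for t
    by (induction t) (simp_all only: eval_magma.simps magma_par.simps \<phi> B.part_mul)
  have E_part: "E f \<in> pB i" if "f \<in> free_part i" for f i
    unfolding E_def
  proof (intro B.subspace_sum B.subspace_scale B.subspace_part)
    fix t assume "t \<in> Poly_Mapping.keys f"
    then show "?e t \<in> pB i" using that e_part[of t] by (auto simp: free_part_def)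
  qed
  have "free.ideal_gen leibniz_relators \<subseteq> {f. E f = 0}"
  proof (rule free.ideal_gen_minimal)
    show "leibniz_relators \<subseteq> {f. E f = 0}"
    proof
      fix r :: "('x, 'k) free" assume "r \<in> leibniz_relators"
      then obtain x y z h i j where r: "r = free_mul x (free_mul y z) -
          (free_mul (free_mul x y) z - free_scale (koszul j i) (free_mul (free_mul x z) y))"
        and p: "x \<in> free_part h" "y \<in> free_part i" "z \<in> free_part j"
        unfolding leibniz_relators_def by blast
      show "r \<in> {f. E f = 0}"
        using B.leibniz[OF p[THEN E_part]] by (simp add: r E_diff E_mul E_scale)
    qed
    show "free.ideal {f. E f = 0}"
      by (auto simp: free.ideal_def free.subspace_def E_0 E_add E_scale E_mul)
  qed
  then have E_rel: "E f = E g" if "leibniz_rel f g" for f g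
    using that E_diff[of f g] by (auto simp: leibniz_rel_def)
  define H where "H x = E (rep_lb x)" for x
  have H: "H (abs_lb f) = E f" for f
    unfolding H_def by (rule E_rel, rule lb.abs_eq_iff[THEN iffD1], rule Quotient3_abs_rep[OF Quotient3_lb])
  have H_hom: "superalgebra_hom lb_scale lb_mul lb_part sB mB pB H"
    unfolding superalgebra_hom_def
  proof (intro conjI allI)
    fix x y :: "('x, 'k) lb" and c i
    obtain f g where fg: "x = abs_lb f" "y = abs_lb g" using abs_lb_ex by blast
    show "H (x + y) = H x + H y" by (simp add: fg plus_lb.abs_eq H E_add)
    show "H (lb_scale c x) = sB c (H x)" by (simp add: fg lb_scale.abs_eq H E_scale)
    show "H (lb_mul x y) = mB (H x) (H y)" by (simp add: fg lb_mul.abs_eq H E_mul)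
    show "H ` lb_part i \<subseteq> pB i" by (auto simp: lb_part_def H E_part)
  qed
  have H_gen: "H (lb_gen x) = \<phi> x" for x
    by (simp add: lb_gen.abs_eq H E_single)
  show ?thesis
  proof (rule ex1I[of _ H])
    show "superalgebra_hom lb_scale lb_mul lb_part sB mB pB H \<and> (\<forall>x. H (lb_gen x) = \<phi> x)"
      using H_hom H_gen by blast
    fix h assume h: "superalgebra_hom lb_scale lb_mul lb_part sB mB pB h \<and> (\<forall>x. h (lb_gen x) = \<phi> x)"
    have he: "h (eval_magma lb_mul lb_gen t) = ?e t" for t
      using h by (induction t) (auto simp: superalgebra_hom_def)
    have "h x = H x" for x
    proof -
      obtain f where abs_lb: "x = abs_lb f" using abs_lb_ex by blast
      have "h (abs_lb f) = E f"
        unfolding abs_lb_eq_sum E_def hom_sum[OF conjunct1[OF h]]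
        using h he by (auto simp: superalgebra_hom_def)
      then show ?thesis by (simp add: abs_lb H)
    qed
    then show "h = H" by blast
  qed
qed

theorem mlb_universal:
  fixes \<phi> :: "'x::super_set \<Rightarrow> 'b::ab_group_add" and sB :: "'k::field \<Rightarrow> 'b \<Rightarrow> 'b"
  assumes "metabelian_leibniz_superalgebra sB mB pB" and \<phi>: "\<And>x. \<phi> x \<in> pB (par x)"
  shows "\<exists>!h. superalgebra_hom mlb_scale mlb_mul mlb_part sB mB pB h \<and> (\<forall>x. h (mlb_gen x) = \<phi> x)"
proof -
  interpret B: metabelian_leibniz_superalgebra sB mB pB by fact
  obtain E where E: "superalgebra_hom lb_scale lb_mul lb_part sB mB pB E" "\<And>x. E (lb_gen x) = \<phi> x"
    and uniq: "\<And>h. superalgebra_hom lb_scale lb_mul lb_part sB mB pB h \<Longrightarrow>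
      (\<forall>x. h (lb_gen x) = \<phi> x) \<Longrightarrow> h = E"
    using lb_universal[OF B.leibniz_superalgebra_axioms \<phi>] by blast
  have E_add: "E (f + g) = E f + E g" and E_scale: "E (lb_scale c f) = sB c (E f)"
    and E_mul: "E (lb_mul f g) = mB (E f) (E g)" for f g c
    using E(1) unfolding superalgebra_hom_def by blast+
  have E_part: "E f \<in> pB i" if "f \<in> lb_part i" for f i
    using E(1) that unfolding superalgebra_hom_def by blast
  have E_0: "E 0 = 0" using E_add[of 0 0] by simp
  have E_diff: "E (f - g) = E f - E g" for f g
    using E_add[of "f - g" g] by simp
  have "lb.ideal_gen metabelian_relators \<subseteq> {f. E f = 0}"
  proof (rule lb.ideal_gen_minimal)
    show "metabelian_relators \<subseteq> {f. E f = 0}"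
    proof
      fix r :: "('x, 'k) lb" assume "r \<in> metabelian_relators"
      then obtain cs ds where r: "r = lb_mul (lb_word cs) (lb_word ds)"
        and l: "length cs \<ge> 2" "length ds \<ge> 2"
        unfolding metabelian_relators_def by blast
      have dec: "\<exists>u v. lb_word w = (lb_mul u v :: ('x, 'k) lb)" if "length w \<ge> 2" for w
        
      proof (cases w rule: rev_cases)
        case (snoc v a)
        then have "v \<noteq> []" using that by auto
        then show ?thesis using lb_word_snoc[of v a, where ?'b='k] unfolding snoc by blast
      qed (use that in auto)
      obtain u v u' v' where "lb_word cs = (lb_mul u v :: ('x, 'k) lb)"
        "lb_word ds = (lb_mul u' v' :: ('x, 'k) lb)"
        using dec[OF l(1)] dec[OF l(2)] by blast
      then show "r \<in> {f. E f = 0}" by (simp add: r E_mul B.metabelian)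
    qed
    show "lb.ideal {f. E f = 0}"
      by (auto simp: lb.ideal_def lb.subspace_def E_0 E_add E_scale E_mul)
  qed
  then have E_rel: "E f = E g" if "metabelian_rel f g" for f g
    using that E_diff[of f g] by (auto simp: metabelian_rel_def)
  define H where "H x = E (rep_mlb x)" for x
  have H: "H (abs_mlb f) = E f" for f
    unfolding H_def by (rule E_rel, rule mlb.abs_eq_iff[THEN iffD1], rule Quotient3_abs_rep[OF Quotient3_mlb])
  show ?thesis
  proof (rule ex1I[of _ H])
    have "superalgebra_hom mlb_scale mlb_mul mlb_part sB mB pB H"
      unfolding superalgebra_hom_def
    proof (intro conjI allI)
      fix x y :: "('x, 'k) mlb" and c i
      obtain f g where fg: "x = abs_mlb f" "y = abs_mlb g" using abs_mlb_ex by blast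
      show "H (x + y) = H x + H y" by (simp add: fg plus_mlb.abs_eq H E_add)
      show "H (mlb_scale c x) = sB c (H x)" by (simp add: fg mlb_scale.abs_eq H E_scale)
      show "H (mlb_mul x y) = mB (H x) (H y)" by (simp add: fg mlb_mul.abs_eq H E_mul)
      show "H ` mlb_part i \<subseteq> pB i" by (auto simp: mlb_part_def H E_part)
    qed
    moreover have "H (mlb_gen x) = \<phi> x" for x
      by (simp add: mlb_gen.abs_eq H E(2))
    ultimately show "superalgebra_hom mlb_scale mlb_mul mlb_part sB mB pB H \<and> (\<forall>x. H (mlb_gen x) = \<phi> x)"
      by blast
    fix h assume h: "superalgebra_hom mlb_scale mlb_mul mlb_part sB mB pB h \<and> (\<forall>x. h (mlb_gen x) = \<phi> x)"
    have "(\<lambda>f. h (abs_mlb f)) = E"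
    proof (rule uniq)
      show "superalgebra_hom lb_scale lb_mul lb_part sB mB pB (\<lambda>f. h (abs_mlb f))"
        using h unfolding superalgebra_hom_def mlb_part_def image_image
        by (auto simp: plus_mlb.abs_eq[symmetric] mlb_scale.abs_eq[symmetric] mlb_mul.abs_eq[symmetric])
      show "\<forall>x. h (abs_mlb (lb_gen x)) = \<phi> x"
        using h by (simp add: mlb_gen.abs_eq)
    qed
    then have "h (abs_mlb f) = H (abs_mlb f)" for f
      by (simp add: H fun_eq_iff)
    then show "h = H"
      by (metis ext abs_mlb_ex)
  qed
qed


section \<open>Groebner-Shirshov bases in the free Leibniz superalgebra\<close>

text \<open>A monomial of NF(X) is given by its nonempty word of generators.  All generators have
  degree 1, so degree and length of a monomial both are the length of its word, and the
  monomial order is the length-lexicographic order on words.  Coefficients are coordinates with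
  respect to the linear basis NF(X).\<close>

definition NF :: "('x::super_set, 'k::field) lb set"
  where "NF = lb_word ` {w. w \<noteq> []}"

definition word_less :: "'x::linorder list \<Rightarrow> 'x list \<Rightarrow> bool"
  where "word_less u v \<longleftrightarrow> (u, v) \<in> lenlex {(a, b). a < b}"

definition monomials :: "('x::super_set, 'k::field) lb \<Rightarrow> 'x list set"
  where "monomials f = {w. w \<noteq> [] \<and> lb.representation NF f (lb_word w) \<noteq> 0}"

definition lead :: "('x::{wellorder,super_set}, 'k::field) lb \<Rightarrow> 'x list"
  where "lead f = (THE w. w \<in> monomials f \<and> (\<forall>v\<in>monomials f. v \<noteq> w \<longrightarrow> word_less v w))"

definition monic :: "('x::{wellorder,super_set}, 'k::field) lb \<Rightarrow> bool"
  where "monic f \<longleftrightarrow> f \<noteq> 0 \<and> lb.representation NF f (lb_word (lead f)) = 1"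

definition homogeneous :: "('x::super_set, 'k::field) lb \<Rightarrow> bool"
  where "homogeneous f \<longleftrightarrow> (\<exists>i. \<forall>w\<in>monomials f. word_par w = i)"

definition normal_poly :: "('x::{wellorder,super_set}, 'k::field) lb \<Rightarrow> ('x, 'k) lb \<Rightarrow> bool"
  where "normal_poly s h \<longleftrightarrow>
    (\<exists>as. h = left_normed lb_mul (s # map lb_gen as)) \<or>
    (length (lead s) = 1 \<and>
      (\<exists>as bs. as \<noteq> [] \<and> h = left_normed lb_mul (map lb_gen as @ s # map lb_gen bs)))"

definition trivial_below ::
    "('x::{wellorder,super_set}, 'k::field) lb set \<Rightarrow> 'x list \<Rightarrow> ('x, 'k) lb \<Rightarrow> bool"
  where "trivial_below S \<mu> f \<longleftrightarrow>
    f \<in> lb.span {h. \<exists>s\<in>S. normal_poly s h \<and> word_less (lead h) \<mu>}"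

definition trivial_deg ::
    "('x::{wellorder,super_set}, 'k::field) lb set \<Rightarrow> nat \<Rightarrow> ('x, 'k) lb \<Rightarrow> bool"
  where "trivial_deg S n f \<longleftrightarrow>
    f \<in> lb.span {h. \<exists>s\<in>S. normal_poly s h \<and> length (lead h) \<le> n}"

definition GS_basis :: "('x::{wellorder,super_set}, 'k::field) lb set \<Rightarrow> bool"
  where "GS_basis S \<longleftrightarrow>
    (\<forall>s\<in>S. monic s \<and> homogeneous s) \<and>
    (\<forall>f\<in>S. \<forall>g\<in>S. \<forall>h. f \<noteq> g \<and> normal_poly g h \<and> lead f = lead h \<longrightarrow>
      trivial_below S (lead f) (f - h)) \<and>
    (\<forall>f\<in>S. length (lead f) > 1 \<longrightarrow>
      (\<forall>\<mu>. \<mu> \<noteq> [] \<and> lb_mul (lb_word \<mu>) f \<noteq> 0 \<longrightarrow>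
        trivial_deg S (length \<mu> + length (lead f)) (lb_mul (lb_word \<mu>) f)))"

definition S1 :: "('x::{wellorder,super_set}, 'k::field) lb set"
  where "S1 =
    {lb_word (cs @ [a1, a2]) - lb_scale (koszul (par a1) (par a2)) (lb_word (cs @ [a2, a1]))
      | cs a1 a2. length cs \<ge> 2 \<and> a2 < a1}"

definition S2 :: "('x::{wellorder,super_set}, 'k::field) lb set"
  where "S2 = {lb_word (cs @ [a, a]) | cs a. length cs \<ge> 2 \<and> par a = 1}"

end

theory Submission
  imports Defs "HOL-Library.Multiset"
begin

text \<open>
  Let \<open>A\<close> be an associative superalgebra with a monomial basis, acting on the right of
  \<open>M = V \<otimes> (k \<oplus> A)\<close>. With \<open>(m, g) (n, h) = (m h, [g, h])\<close>, where \<open>[g, h]\<close> is the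
  supercommutator, \<open>M \<oplus> A\<close> is a Leibniz superalgebra, and sending a generator \<open>x\<close> to
  \<open>x \<otimes> 1 + x\<close> maps the word \<open>a\<^sub>1 \<dots> a\<^sub>n\<close> to an element with \<open>M\<close>-component
  \<open>a\<^sub>1 \<otimes> a\<^sub>2 \<dots> a\<^sub>n\<close>.
  For \<open>A\<close> the free associative algebra this shows that NF(X) is independent. For
  \<open>A = V \<otimes> S(V)\<close> with \<open>(a \<otimes> s) (b \<otimes> t) = a \<otimes> s b t\<close> and \<open>S(V)\<close> the free
  supercommutative algebra, \<open>A [A, A] = 0\<close>, so the model is metabelian, and the irreducible words
  stay independent in the free metabelian Leibniz superalgebra.

  Rewriting with leading monomials brings every element to a combination of normal polynomials and
  irreducible words without increasing leading monomials. If the element vanishes in the metabelian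
  quotient, independence forces the irreducible part to be zero; applied to both kinds of
  compositions, this is the Groebner-Shirshov property.
\<close>

section \<open>Superalgebras given by structure constants\<close>

lift_definition pm_scale :: "'k::field \<Rightarrow> ('b \<Rightarrow>\<^sub>0 'k) \<Rightarrow> ('b \<Rightarrow>\<^sub>0 'k)"
  is "\<lambda>c f b. c * f b"
  by (rule finite_subset[rotated]) auto

interpretation pm: vector_space pm_scale
  by unfold_locales (transfer; simp add: fun_eq_iff algebra_simps)+

lemma pm_scale_single: "pm_scale c (Poly_Mapping.single b d) = Poly_Mapping.single b (c * d)"
  by (rule poly_mapping_eqI) (simp add: pm_scale.rep_eq lookup_single when_def)

lemma pm_eq_sum:
  "f = (\<Sum>b\<in>Poly_Mapping.keys f. pm_scale (Poly_Mapping.lookup f b) (Poly_Mapping.single b 1))"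
  by (rule poly_mapping_eqI)
    (simp add: lookup_sum pm_scale.rep_eq lookup_single when_def in_keys_iff
      if_distrib[of "(*) _"] sum.delta' cong: if_cong)

lemma pm_span_singles: "f \<in> pm.span ((\<lambda>b. Poly_Mapping.single b 1) ` Poly_Mapping.keys f)"
  by (subst pm_eq_sum[of f], intro pm.span_sum pm.span_scale pm.span_base imageI)

definition pm_lin :: "('b \<Rightarrow> ('c \<Rightarrow>\<^sub>0 'k)) \<Rightarrow> ('b \<Rightarrow>\<^sub>0 'k::field) \<Rightarrow> ('c \<Rightarrow>\<^sub>0 'k)"
  where "pm_lin \<phi> f = (\<Sum>b\<in>Poly_Mapping.keys f. pm_scale (Poly_Mapping.lookup f b) (\<phi> b))"

lemma pm_lin_superset:
  assumes "finite T" "Poly_Mapping.keys f \<subseteq> T"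
  shows "pm_lin \<phi> f = (\<Sum>b\<in>T. pm_scale (Poly_Mapping.lookup f b) (\<phi> b))"
  unfolding pm_lin_def by (rule sum.mono_neutral_left[OF assms]) (auto simp: in_keys_iff)

lemma pm_lin_add: "pm_lin \<phi> (f + g) = pm_lin \<phi> f + pm_lin \<phi> g"
proof -
  let ?T = "Poly_Mapping.keys f \<union> Poly_Mapping.keys g"
  have "pm_lin \<phi> (f + g) = (\<Sum>b\<in>?T. pm_scale (Poly_Mapping.lookup (f + g) b) (\<phi> b))"
    by (rule pm_lin_superset) (auto simp: in_keys_iff lookup_add)
  then show ?thesis
    by (simp add: pm_lin_superset[of ?T f] pm_lin_superset[of ?T g] lookup_add
        pm.scale_left_distrib sum.distrib)
qed

lemma pm_lin_scale: "pm_lin \<phi> (pm_scale c f) = pm_scale c (pm_lin \<phi> f)"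
proof -
  have "pm_lin \<phi> (pm_scale c f) =
      (\<Sum>b\<in>Poly_Mapping.keys f. pm_scale (Poly_Mapping.lookup (pm_scale c f) b) (\<phi> b))"
    by (rule pm_lin_superset) (auto simp: in_keys_iff pm_scale.rep_eq)
  then show ?thesis by (simp add: pm_lin_def pm_scale.rep_eq pm.scale_sum_right)
qed

lemma pm_lin_single: "pm_lin \<phi> (Poly_Mapping.single b c) = pm_scale c (\<phi> b)"
  using pm_lin_superset[of "{b}" "Poly_Mapping.single b c" \<phi>] by simp

lemma pm_lin_add_fun: "pm_lin (\<lambda>b. \<phi> b + \<psi> b) f = pm_lin \<phi> f + pm_lin \<psi> f"
  by (simp add: pm_lin_def pm.scale_right_distrib sum.distrib)

lemma pm_lin_scale_fun: "pm_lin (\<lambda>b. pm_scale c (\<phi> b)) f = pm_scale c (pm_lin \<phi> f)"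
  by (simp add: pm_lin_def pm.scale_sum_right mult.commute)

definition pm_mul ::
    "('b \<Rightarrow> 'b \<Rightarrow> ('b \<Rightarrow>\<^sub>0 'k::field)) \<Rightarrow> ('b \<Rightarrow>\<^sub>0 'k) \<Rightarrow> ('b \<Rightarrow>\<^sub>0 'k) \<Rightarrow> ('b \<Rightarrow>\<^sub>0 'k)"
  where "pm_mul \<mu> f g = pm_lin (\<lambda>b. pm_lin (\<mu> b) g) f"

definition pm_part :: "('b \<Rightarrow> bit) \<Rightarrow> bit \<Rightarrow> ('b \<Rightarrow>\<^sub>0 'k::field) set"
  where "pm_part p i = {f. \<forall>b. p b \<noteq> i \<longrightarrow> Poly_Mapping.lookup f b = 0}"

lemma nonassoc_algebra_pm_mul: "nonassoc_algebra pm_scale (pm_mul \<mu>)"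
  by unfold_locales
    (simp_all add: pm_mul_def pm_lin_add pm_lin_scale pm_lin_add_fun pm_lin_scale_fun)

lemma pm_mul_single:
  "pm_mul \<mu> (Poly_Mapping.single a c) (Poly_Mapping.single b d) = pm_scale (c * d) (\<mu> a b)"
  by (simp add: pm_mul_def pm_lin_single)

lemma subspace_pm_part: "pm.subspace (pm_part p i)"
  by (auto simp: pm.subspace_def pm_part_def lookup_add pm_scale.rep_eq)

text \<open>Makes homogeneous elements accessible to span induction over basis vectors of one
  parity.\<close>

lemma pm_part_span:
  "pm_part p i = pm.span ((\<lambda>b. Poly_Mapping.single b (1::'k::field)) ` {b. p b = i})"
proof
  show "pm_part p i \<subseteq> pm.span ((\<lambda>b. Poly_Mapping.single b (1::'k)) ` {b. p b = i})"
  proof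
    fix f :: "'a \<Rightarrow>\<^sub>0 'k" assume "f \<in> pm_part p i"
    then have "Poly_Mapping.keys f \<subseteq> {b. p b = i}" by (auto simp: pm_part_def in_keys_iff)
    then show "f \<in> pm.span ((\<lambda>b. Poly_Mapping.single b 1) ` {b. p b = i})"
      using pm_span_singles[of f] pm.span_mono image_mono by (metis (no_types, lifting) subsetD)
  qed
  show "pm.span ((\<lambda>b. Poly_Mapping.single b (1::'k)) ` {b. p b = i}) \<subseteq> pm_part p i"
    by (rule pm.span_minimal[OF _ subspace_pm_part])
      (auto simp: pm_part_def lookup_single when_def)
qed

lemma superalgebra_pm:
  assumes "\<And>a b. \<mu> a b \<in> pm_part p (p a + p b)"
  shows "superalgebra pm_scale (pm_mul \<mu>) (pm_part p)"
proof -
  interpret nonassoc_algebra pm_scale "pm_mul \<mu>" by (rule nonassoc_algebra_pm_mul)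
  show ?thesis
  proof
    fix f g :: "'a \<Rightarrow>\<^sub>0 'b" and i j
    show "pm.subspace (pm_part p i :: ('a \<Rightarrow>\<^sub>0 'b) set)" by (rule subspace_pm_part)
    have "f = 0" if "f \<in> pm_part p 0 \<inter> pm_part p 1" for f :: "'a \<Rightarrow>\<^sub>0 'b"
    proof (rule poly_mapping_eqI)
      fix b
      show "Poly_Mapping.lookup f b = Poly_Mapping.lookup 0 b"
        using that by (cases "p b = 0") (auto simp: pm_part_def)
    qed
    then show "pm_part p 0 \<inter> pm_part p 1 = {0 :: 'a \<Rightarrow>\<^sub>0 'b}"
      by (auto simp: pm_part_def)
    have "f \<in> {x + y |x y. x \<in> pm_part p 0 \<and> y \<in> pm_part p 1}"
      unfolding pm_part_span pm.span_Un[symmetric]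
      using pm_span_singles[of f]
      by (rule rev_subsetD, intro pm.span_mono) (auto simp: image_def, metis)
    then show "\<exists>y\<in>pm_part p 0. \<exists>z\<in>pm_part p 1. f = y + z" by blast
    assume "f \<in> pm_part p i" "g \<in> pm_part p j"
    then show "pm_mul \<mu> f g \<in> pm_part p (i + j)"
      unfolding pm_part_span
    proof (rule mul_span[rotated])
      fix a b :: "'a \<Rightarrow>\<^sub>0 'b"
      assume "a \<in> (\<lambda>b. Poly_Mapping.single b 1) ` {b. p b = i}"
        "b \<in> (\<lambda>b. Poly_Mapping.single b 1) ` {b. p b = j}"
      then obtain c d where cd: "a = Poly_Mapping.single c 1" "b = Poly_Mapping.single d 1"
        "p c = i" "p d = j" by blast
      show "pm_mul \<mu> a b \<in> pm.span ((\<lambda>b. Poly_Mapping.single b 1) ` {b. p b = i + j})"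
        unfolding pm_part_span[symmetric] cd(1,2) pm_mul_single mult_1 pm.scale_one
          cd(3,4)[symmetric] by (rule assms)
    qed
  qed
qed

text \<open>By linearity the Leibniz identity has to be checked on basis vectors only. Its sign
  depends on the parities of \<open>y\<close> and \<open>z\<close> alone, so \<open>x\<close>
  extends to arbitrary elements, while \<open>y\<close> and \<open>z\<close> each extend within one
  parity component.\<close>

lemma leibniz_superalgebra_pm:
  assumes \<mu>: "\<And>a b. \<mu> a b \<in> pm_part p (p a + p b)"
    and leib: "\<And>a b c. pm_mul \<mu> (Poly_Mapping.single a 1) (\<mu> b c) =
      pm_mul \<mu> (\<mu> a b) (Poly_Mapping.single c 1)
      - pm_scale (koszul (p c) (p b)) (pm_mul \<mu> (\<mu> a c) (Poly_Mapping.single b 1))"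
  shows "leibniz_superalgebra pm_scale (pm_mul \<mu>) (pm_part p)"
proof -
  interpret superalgebra pm_scale "pm_mul \<mu>" "pm_part p" by (rule superalgebra_pm[OF \<mu>])
  let ?m = "pm_mul \<mu>"
  let ?L = "\<lambda>k x y z. ?m x (?m y z) = ?m (?m x y) z - pm_scale k (?m (?m x z) y)"
  note lin = mul_add_left mul_add_right mul_scale_left mul_scale_right
    pm.scale_right_distrib pm.scale_right_diff_distrib
  have 1: "?L (koszul (p c) (p b)) (Poly_Mapping.single a 1) (Poly_Mapping.single b 1) (Poly_Mapping.single c 1)"
    for a b c
    by (simp add: pm_mul_single leib)
  have 2: "?L (koszul (p c) (p b)) x (Poly_Mapping.single b 1) (Poly_Mapping.single c 1)" for b c x
    using pm_span_singles[of x]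
  proof (induction rule: pm.span_induct_alt)
    case (step k u x)
    then obtain a where "u = Poly_Mapping.single a 1" by blast
    then show ?case using step.IH 1[where a=a and b=b and c=c] by (simp only: lin) (simp add: mult.commute)
  qed simp
  have 3: "?L (koszul (p c) i) x y (Poly_Mapping.single c 1)" if "y \<in> pm_part p i" for c x y i
    using that unfolding pm_part_span
  proof (induction rule: pm.span_induct_alt)
    case (step k u y)
    then obtain b where "u = Poly_Mapping.single b 1" "p b = i" by blast
    then show ?case using step.IH 2[where b=b and c=c and x=x] by (simp only: lin) (simp add: mult.commute)
  qed simp
  have 4: "?L (koszul j i) x y z" if "y \<in> pm_part p i" "z \<in> pm_part p j" for x y z i j
    using that(2) unfolding pm_part_span
  proof (induction rule: pm.span_induct_alt)
    case (step k u z)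
    then obtain c where "u = Poly_Mapping.single c 1" "p c = j" by blast
    then show ?case using step.IH 3[OF that(1), where c=c and x=x] by (simp only: lin) (simp add: mult.commute)
  qed simp
  show ?thesis by unfold_locales (rule 4)
qed

section \<open>The Leibniz superalgebra of a monomial associative superalgebra\<close>

lemma koszul_commute: "koszul i j = koszul j i"
  by (simp add: koszul_def mult.commute)

lemma koszul_add_right: "koszul i (j + l) = (koszul i j * koszul i l :: 'k::field)"
  by (cases "i = 0"; cases "j = 0"; cases "l = 0") (simp_all add: koszul_def)

lemma koszul_add_left: "koszul (j + l) i = (koszul j i * koszul l i :: 'k::field)"
  by (simp only: koszul_commute[of _ i] koszul_add_right)

lemma koszul_zero: "koszul 0 i = 1" "koszul i 0 = 1"
  by (simp_all add: koszul_def)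

lemma koszul_square: "koszul i j * koszul i j = (1 :: 'k::field)"
  by (simp add: koszul_def)

text \<open>Basis vectors multiply by \<open>g h = cf g h (op g h)\<close>, and the first two
  conditions make this associative. \<open>cf\<close> may take the value 0, so basis vectors can
  multiply to zero.\<close>

locale monomial_superalgebra =
  fixes op :: "'g \<Rightarrow> 'g \<Rightarrow> 'g" and cf :: "'g \<Rightarrow> 'g \<Rightarrow> 'k::field" and p :: "'g \<Rightarrow> bit"
  assumes op_assoc: "op (op g h) l = op g (op h l)"
    and cf_cocycle: "cf g h * cf (op g h) l = cf h l * cf g (op h l)"
    and p_op: "p (op g h) = p g + p h"
begin

lemma koszul_p_op:
  "koszul i (p (op g h)) = (koszul i (p g) * koszul i (p h) :: 'k)"
  "koszul (p (op g h)) i = (koszul (p g) i * koszul (p h) i :: 'k)"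
  by (simp_all only: p_op koszul_add_left koszul_add_right)

text \<open>The basis vector \<open>Inl (x, None)\<close> is \<open>x \<otimes> 1\<close>, and \<open>Inl (x, Some g)\<close> is \<open>x \<otimes> g\<close>.\<close>

fun model_par :: "('x::super_set \<times> 'g option) + 'g \<Rightarrow> bit" where
  "model_par (Inl (x, None)) = par x"
| "model_par (Inl (x, Some g)) = par x + p g"
| "model_par (Inr g) = p g"

definition bracket :: "'g \<Rightarrow> 'g \<Rightarrow> (('x::super_set \<times> 'g option) + 'g) \<Rightarrow>\<^sub>0 'k"
  where "bracket g h = Poly_Mapping.single (Inr (op g h)) (cf g h)
    - pm_scale (koszul (p g) (p h)) (Poly_Mapping.single (Inr (op h g)) (cf h g))"

fun model_op :: "('x::super_set \<times> 'g option) + 'g \<Rightarrow> ('x \<times> 'g option) + 'g \<Rightarrow>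
    (('x \<times> 'g option) + 'g) \<Rightarrow>\<^sub>0 'k" where
  "model_op a (Inl m) = 0"
| "model_op (Inl (x, None)) (Inr h) = Poly_Mapping.single (Inl (x, Some h)) 1"
| "model_op (Inl (x, Some g)) (Inr h) = Poly_Mapping.single (Inl (x, Some (op g h))) (cf g h)"
| "model_op (Inr g) (Inr h) = bracket g h"

abbreviation "model_mul \<equiv> pm_mul model_op"

sublocale model: nonassoc_algebra pm_scale model_mul
  by (rule nonassoc_algebra_pm_mul)

lemma single_part: "i = model_par b \<Longrightarrow> Poly_Mapping.single b c \<in> pm_part model_par i"
  by (auto simp: pm_part_def lookup_single when_def)

lemma model_op_part: "model_op a b \<in> pm_part model_par (model_par a + model_par b)"
proof -
  have "bracket g h \<in> pm_part model_par (p g + p h)" for g h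
    unfolding bracket_def
    by (intro pm.subspace_diff pm.subspace_scale subspace_pm_part single_part)
      (simp_all only: model_par.simps p_op add.commute)
  then show ?thesis
    by (cases "(a, b)" rule: model_op.cases)
      (auto simp only: model_op.simps model_par.simps p_op add.assoc
        intro!: single_part pm.subspace_0[OF subspace_pm_part])
qed

lemma model_mul_Inr_scaled:
  "model_mul (Poly_Mapping.single (Inr g) c) (Poly_Mapping.single (Inr h) d) = pm_scale (c * d) (bracket g h)"
  by (simp add: pm_mul_single)

text \<open>The product \<open>g h l\<close> in \<open>A\<close>. Brackets nested on either side
  expand into these, which gives both sides of the Jacobi identity a common normal form.\<close>

definition triple :: "'g \<Rightarrow> 'g \<Rightarrow> 'g \<Rightarrow> (('x::super_set \<times> 'g option) + 'g) \<Rightarrow>\<^sub>0 'k"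
  where "triple g h l = Poly_Mapping.single (Inr (op g (op h l))) (cf h l * cf g (op h l))"

lemma cf_cocycle_left_commute:
  "cf h l * (k * cf g (op h l)) = cf g h * (k * cf (op g h) l)"
  "cf h l * (k * (k' * cf g (op h l))) = cf g h * (k * (k' * cf (op g h) l))"
  using cf_cocycle[of g h l] by (simp_all add: mult.left_commute)

lemma model_mul_bracket_right: "model_mul (Poly_Mapping.single (Inr g) 1) (bracket h l) =
    triple g h l - pm_scale (koszul (p g) (p h) * koszul (p g) (p l)) (triple h l g)
    - pm_scale (koszul (p h) (p l)) (triple g l h
      - pm_scale (koszul (p g) (p h) * koszul (p g) (p l)) (triple l h g))"
  by (simp add: bracket_def[of h l] model.mul_diff_right model.mul_scale_right model_mul_Inr_scaled)
    (simp add: bracket_def triple_def pm_scale_single op_assoc cf_cocycle[symmetric]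
      cf_cocycle_left_commute koszul_p_op
      pm.scale_right_diff_distrib mult.commute mult.left_commute)

lemma model_mul_bracket_left: "model_mul (bracket g h) (Poly_Mapping.single (Inr l) 1) =
    triple g h l - pm_scale (koszul (p g) (p l) * koszul (p h) (p l)) (triple l g h)
    - pm_scale (koszul (p g) (p h)) (triple h g l
      - pm_scale (koszul (p g) (p l) * koszul (p h) (p l)) (triple l h g))"
  by (simp add: bracket_def[of g h] model.mul_diff_left model.mul_scale_left model_mul_Inr_scaled)
    (simp add: bracket_def triple_def pm_scale_single op_assoc cf_cocycle[symmetric]
      cf_cocycle_left_commute koszul_p_op
      pm.scale_right_diff_distrib mult.commute mult.left_commute)

text \<open>If \<open>b\<close> or \<open>c\<close> lies in \<open>M\<close>, every term vanishes,
  since right factors from \<open>M\<close> give zero. For \<open>b\<close> and \<open>c\<close> in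
  \<open>A\<close> the identity says that \<open>A\<close> acts associatively if \<open>a\<close> is
  in \<open>M\<close>, and it is the super Jacobi identity for commutators if \<open>a\<close> is in
  \<open>A\<close>.\<close>

lemma model_leibniz:
  fixes a b c :: "('x::super_set \<times> 'g option) + 'g"
  shows "model_mul (Poly_Mapping.single a 1) (model_op b c) =
    model_mul (model_op a b) (Poly_Mapping.single c 1)
    - pm_scale (koszul (model_par c) (model_par b)) (model_mul (model_op a c) (Poly_Mapping.single b 1))"
proof (cases b)
  case (Inl m)
  show ?thesis
  proof (cases c)
    case (Inr h)
    have "model_mul x (model_op (Inl m) (Inr h)) = 0" for x
      by (cases m; cases "snd m") (simp_all add: pm_mul_def pm_lin_single pm_lin_def)
    moreover have "model_mul x (Poly_Mapping.single (Inl m) 1) = 0" for x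
      by (simp add: pm_mul_def pm_lin_single pm_lin_def)
    ultimately show ?thesis
      by (simp add: Inl Inr)
  qed (simp add: Inl)
next
  case b: (Inr g)
  show ?thesis
  proof (cases c)
    case (Inl m)
    have "model_mul x (Poly_Mapping.single (Inl m) 1) = 0" for x
      by (simp add: pm_mul_def pm_lin_single pm_lin_def)
    then show ?thesis by (simp add: Inl)
  next
    case c: (Inr h)
    have comm: "koszul (p h) (p g) = (koszul (p g) (p h) :: 'k)" by (rule koszul_commute)
    show ?thesis
    proof (cases a)
      case (Inl m)
      obtain x y where m: "m = (x, y)" by fastforce
      have co: "cf h l * cf g (op h l) = cf g h * cf (op g h) l" for g h l
        by (simp add: cf_cocycle)
      show ?thesis
        unfolding b c Inl m
        by (cases y)
          (simp_all add: bracket_def model.mul_diff_right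
            model.mul_scale_right pm_mul_single pm_scale_single op_assoc co comm mult.assoc)
    next
      case (Inr e)
      have sq: "koszul i j * (koszul i j * k) = k" for i j and k :: 'k
        by (simp add: mult.assoc[symmetric] koszul_square)
      show ?thesis
        unfolding b c Inr
        by (simp add: model_mul_bracket_right model_mul_bracket_left comm koszul_commute[of "p h" "p e"] koszul_commute[of "p g" "p e"]
            pm.scale_right_diff_distrib mult.commute mult.left_commute koszul_square sq)
    qed
  qed
qed

lemma leibniz_model: "leibniz_superalgebra pm_scale model_mul (pm_part model_par)"
  by (rule leibniz_superalgebra_pm[OF model_op_part model_leibniz])

end

text \<open>The functionals \<open>\<phi> i\<close> are diagonal on the vectors \<open>e i\<close>,
  so \<open>\<phi> i\<close> isolates the coefficient of \<open>e i\<close> in a linear combination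
  up to a nonzero factor.\<close>

lemma (in vector_space) independent_if_coordinates:
  fixes \<phi> :: "'i \<Rightarrow> 'b \<Rightarrow> 'a"
  assumes add: "\<And>i x y. \<phi> i (x + y) = \<phi> i x + \<phi> i y"
    and scl: "\<And>i c x. \<phi> i (scale c x) = c * \<phi> i x"
    and diag: "\<And>i. i \<in> I \<Longrightarrow> \<phi> i (e i) \<noteq> 0"
    and off: "\<And>i j. i \<in> I \<Longrightarrow> j \<in> I \<Longrightarrow> i \<noteq> j \<Longrightarrow> \<phi> i (e j) = 0"
  shows "inj_on e I" and "independent (e ` I)"
    and "\<And>r. r \<in> span (e ` I) \<Longrightarrow> (\<And>i. i \<in> I \<Longrightarrow> \<phi> i r = 0) \<Longrightarrow> r = 0"
proof -
  have zero: "\<phi> i 0 = 0" for i using scl[of i 0 0] by simp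
  show inj: "inj_on e I"
    by (rule inj_onI) (metis diag off)
  have vanish: "\<phi> i x = 0" if "x \<in> span (e ` (I - {i}))" "i \<in> I" for i x
    using that(1) by (induction rule: span_induct_alt) (use off that(2) in \<open>auto simp: zero add scl\<close>)
  show ind: "independent (e ` I)"
  proof
    assume "dependent (e ` I)"
    then obtain i where i: "i \<in> I" "e i \<in> span (e ` I - {e i})"
      unfolding dependent_def by blast
    have "e ` I - {e i} \<subseteq> e ` (I - {i})" by blast
    then have "e i \<in> span (e ` (I - {i}))" using i(2) span_mono by blast
    then show False using vanish[of "e i" i] diag i(1) by blast
  qed
  show "r = 0" if r: "r \<in> span (e ` I)" and z: "\<And>i. i \<in> I \<Longrightarrow> \<phi> i r = 0" for r
  proof -
    have "representation (e ` I) r v = 0" for v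
    proof (rule ccontr)
      assume nz: "representation (e ` I) r v \<noteq> 0"
      then obtain i where i: "i \<in> I" "v = e i"
        using representation_ne_zero by fastforce
      let ?c = "representation (e ` I) r"
      let ?F = "{b. ?c b \<noteq> 0}"
      have fin: "finite ?F" by (rule finite_representation)
      \<comment> \<open>The summand at \<open>v = e i\<close> is split off; the remaining sum is
        killed by \<open>\<phi> i\<close>.\<close>
      have "r = (\<Sum>b\<in>?F. scale (?c b) b)"
        using sum_nonzero_representation_eq[OF ind r] by simp
      also have "\<dots> = scale (?c v) v + (\<Sum>b\<in>?F - {v}. scale (?c b) b)"
        using nz fin by (intro sum.remove) auto
      finally have "\<phi> i r = \<phi> i (scale (?c v) v + (\<Sum>b\<in>?F - {v}. scale (?c b) b))"
        by (rule arg_cong)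
      then have "\<phi> i r = ?c v * \<phi> i (e i) + \<phi> i (\<Sum>b\<in>?F - {v}. scale (?c b) b)"
        by (simp only: add scl i(2))
      moreover have "(\<Sum>b\<in>?F - {v}. scale (?c b) b) \<in> span (e ` (I - {i}))"
      proof (intro span_sum span_scale span_base)
        fix b assume "b \<in> ?F - {v}"
        then show "b \<in> e ` (I - {i})" using representation_ne_zero[of "e ` I" r b] i(2) by auto
      qed
      ultimately show False using vanish[OF _ i(1)] z[OF i(1)] diag[OF i(1)] nz by simp
    qed
    then show ?thesis using sum_nonzero_representation_eq[OF ind r] by simp
  qed
qed

section \<open>Images of words in the model\<close>

lemma hom_left_normed:
  assumes "superalgebra_hom sA mA pA sB mB pB h" "w \<noteq> []"
  shows "h (left_normed mA (map g w)) = left_normed mB (map (\<lambda>x. h (g x)) w)"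
  using assms(2)
proof (induction w rule: rev_nonempty_induct)
  case (snoc x xs)
  then show ?case using assms(1) by (simp add: left_normed_snoc superalgebra_hom_def)
qed (simp add: left_normed_single)

context monomial_superalgebra
begin

text \<open>One letter is appended to a product in \<open>k \<oplus> A\<close>. The state holds a
  basis element, with \<open>None\<close> for the adjoined unit, and the scalar accumulated so
  far.\<close>

definition word_step :: "('x \<Rightarrow> 'g) \<Rightarrow> 'g option \<times> 'k \<Rightarrow> 'x \<Rightarrow> 'g option \<times> 'k"
  where "word_step gen st x = (case fst st of
      None \<Rightarrow> (Some (gen x), snd st)
    | Some g \<Rightarrow> (Some (op g (gen x)), snd st * cf g (gen x)))"

definition model_gen :: "('x::super_set \<Rightarrow> 'g) \<Rightarrow> 'x \<Rightarrow> (('x \<times> 'g option) + 'g) \<Rightarrow>\<^sub>0 'k"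
  where "model_gen gen x = Poly_Mapping.single (Inl (x, None)) 1 + Poly_Mapping.single (Inr (gen x)) 1"

lemma model_gen_part:
  "p (gen x) = par x \<Longrightarrow> model_gen gen x \<in> pm_part model_par (par x)"
  unfolding model_gen_def
  by (intro pm.subspace_add subspace_pm_part single_part) simp_all

lemma model_mul_Inl_right: "model_mul x (Poly_Mapping.single (Inl m) c) = 0"
  by (simp add: pm_mul_def pm_lin_single pm_lin_def)

text \<open>\<open>A\<close> is a right ideal of the model: \<open>A M = 0\<close>, and brackets of
  elements of \<open>A\<close> stay in \<open>A\<close>.\<close>

lemma model_mul_no_Inl:
  assumes "\<And>y. Poly_Mapping.lookup r (Inl y) = 0"
  shows "Poly_Mapping.lookup (model_mul r s) (Inl y) = 0"
proof -
  let ?R = "{r :: (('a \<times> 'g option) + 'g) \<Rightarrow>\<^sub>0 'k. \<forall>y. Poly_Mapping.lookup r (Inl y) = 0}"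
  have R: "pm.subspace ?R" by (auto simp: pm.subspace_def lookup_add pm_scale.rep_eq)
  have "model_mul r s \<in> pm.span ?R"
  proof (rule model.mul_span[OF _ pm_span_singles pm_span_singles])
    fix a b :: "(('a \<times> 'g option) + 'g) \<Rightarrow>\<^sub>0 'k"
    assume "a \<in> (\<lambda>b. Poly_Mapping.single b 1) ` Poly_Mapping.keys r"
      "b \<in> (\<lambda>b. Poly_Mapping.single b 1) ` Poly_Mapping.keys s"
    then obtain c d where cd: "a = Poly_Mapping.single c 1" "b = Poly_Mapping.single d 1"
      "c \<in> Poly_Mapping.keys r" by blast
    then obtain g where "c = Inr g"
      using assms by (cases c) (auto simp: in_keys_iff)
    then have "model_mul a b \<in> ?R"
      by (cases d) (auto simp: cd pm_mul_single bracket_def lookup_minus pm_scale.rep_eq lookup_single)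
    then show "model_mul a b \<in> pm.span ?R" by (rule pm.span_base)
  qed
  also have "pm.span ?R \<subseteq> ?R" by (rule pm.span_minimal[OF order_refl R])
  finally show ?thesis by blast
qed

text \<open>Multiplying by the image \<open>x \<otimes> 1 + x\<close> of a letter lets only the
  summand from \<open>A\<close> act, so the \<open>M\<close>-component grows by one factor on the
  right. The remainder \<open>r\<close> lies in \<open>A\<close> and stays there.\<close>

lemma lookup_model_word:
  "Poly_Mapping.lookup (left_normed model_mul (map (model_gen gen) (a # v))) (Inl y) =
    (let st = foldl (word_step gen) (None, 1) v in if y = (a, fst st) then snd st else 0)"
proof -
  let ?st = "\<lambda>v. foldl (word_step gen) (None, 1) v"
  have "\<exists>r. left_normed model_mul (map (model_gen gen) (a # v)) =
      Poly_Mapping.single (Inl (a, fst (?st v))) (snd (?st v)) + r \<and>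
      (\<forall>y. Poly_Mapping.lookup r (Inl y) = 0)"
  proof (induction v rule: rev_induct)
    case Nil
    show ?case
      by (intro exI[of _ "Poly_Mapping.single (Inr (gen a)) 1"])
        (simp add: left_normed_single model_gen_def lookup_single)
  next
    case (snoc x v)
    then obtain r where r: "left_normed model_mul (map (model_gen gen) (a # v)) =
        Poly_Mapping.single (Inl (a, fst (?st v))) (snd (?st v)) + r"
      "\<And>y. Poly_Mapping.lookup r (Inl y) = 0" by blast
    let ?r = "model_mul r (Poly_Mapping.single (Inr (gen x)) 1)"
    have "left_normed model_mul (map (model_gen gen) (a # v @ [x])) =
        model_mul (left_normed model_mul (map (model_gen gen) (a # v))) (model_gen gen x)"
      using left_normed_snoc[of "map (model_gen gen) (a # v)" model_mul "model_gen gen x"] by simp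
    also have "\<dots> = Poly_Mapping.single (Inl (a, fst (?st (v @ [x])))) (snd (?st (v @ [x]))) + ?r"
      unfolding r(1) model_gen_def[of gen x]
      by (simp add: model.mul_add_left model.mul_add_right model_mul_Inl_right pm_mul_single
          word_step_def pm_scale_single split: option.split)
    finally show ?case using model_mul_no_Inl[OF r(2)] by (intro exI[of _ ?r]) simp
  qed
  then obtain r where r: "left_normed model_mul (map (model_gen gen) (a # v)) =
      Poly_Mapping.single (Inl (a, fst (?st v))) (snd (?st v)) + r"
    "\<And>y. Poly_Mapping.lookup r (Inl y) = 0" by blast
  show ?thesis unfolding r(1) Let_def by (simp add: lookup_add lookup_single when_def r(2) eq_commute)
qed

end

text \<open>The assumptions say \<open>g [h, l] = 0\<close>.\<close>

locale right_supercommutative = monomial_superalgebra +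
  assumes op_swap: "op g (op h l) = op g (op l h)"
    and cf_swap: "cf h l * cf g (op h l) = koszul (p h) (p l) * (cf l h * cf g (op l h))"
begin

lemma triple_swap: "triple g h l = pm_scale (koszul (p h) (p l)) (triple g l h)"
  by (simp add: triple_def pm_scale_single cf_swap[of h l g] op_swap[of g h l])

text \<open>The commutator of \<open>[a, b]\<close> and \<open>[c, d]\<close> is a combination of
  \<open>[a, b] [c, d]\<close> and \<open>[c, d] [a, b]\<close>, and both are zero because
  \<open>A [A, A] = 0\<close>.\<close>

lemma model_mul_bracket_bracket: "model_mul (bracket a b) (bracket c d) = 0"
proof -
  \<comment> \<open>Since \<open>g [c, d] = 0\<close>, only the signed term \<open>[c, d] g\<close>
    of the outer commutator survives.\<close>
  have 1: "model_mul (Poly_Mapping.single (Inr g) k) (bracket c d) =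
      pm_scale (k * koszul (p g) (p c) * koszul (p g) (p d))
        (pm_scale (koszul (p c) (p d)) (triple d c g) - triple c d g)" for g k
  proof -
    have "model_mul (Poly_Mapping.single (Inr g) k) (bracket c d) =
        pm_scale k (model_mul (Poly_Mapping.single (Inr g) 1) (bracket c d))"
      by (simp add: model.mul_scale_left[symmetric] pm_scale_single)
    then show ?thesis
      unfolding model_mul_bracket_right triple_swap[of g c d]
      by (simp add: pm.scale_right_diff_distrib mult.commute mult.left_commute)
  qed
  have e: "cf a b * cf v (op a b) = cf b a * koszul (p a) (p b) * cf v (op b a)" for v
    by (simp only: cf_swap[of a b v] mult.assoc mult.left_commute)
  \<comment> \<open>This is \<open>v [a, b] = 0\<close>, multiplied by \<open>u\<close> on the
    left.\<close>
  have 2: "pm_scale (cf a b) (triple u v (op a b)) =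
      pm_scale (cf b a * koszul (p a) (p b)) (triple u v (op b a))" for u v
    unfolding triple_def pm_scale_single op_swap[of v a b] by (simp only: mult.assoc[symmetric] e)
  have 3: "pm_scale (cf a b * k) (triple u v (op a b)) =
      pm_scale (koszul (p a) (p b) * (cf b a * k)) (triple u v (op b a))" for u v k
    using arg_cong[OF 2[of u v], of "pm_scale k"] by (simp add: mult.commute mult.left_commute)
  show ?thesis
    unfolding bracket_def[of a b] model.mul_diff_left model.mul_scale_left 1
    by (simp add: koszul_p_op pm.scale_right_diff_distrib 3 mult.assoc)
      (simp add: mult.commute mult.left_commute)
qed

text \<open>Products lie in the span of the values of \<open>model_op\<close>, which never involve
  \<open>x \<otimes> 1\<close>. This matters because \<open>(x \<otimes> 1) [h, l]\<close> can be
  nonzero, whereas \<open>(x \<otimes> g) [h, l] = x \<otimes> g [h, l] = 0\<close>.\<close>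

lemma model_mul_metabelian: "model_mul (model_mul x y) (model_mul z w) = 0"
proof -
  let ?P = "{model_op a b |a b. True}"
  have prod: "model_mul x y \<in> pm.span ?P" for x y
  proof (rule model.mul_span[OF _ pm_span_singles pm_span_singles])
    fix a b
    assume "a \<in> (\<lambda>b. Poly_Mapping.single b (1 :: 'b)) ` Poly_Mapping.keys x"
      "b \<in> (\<lambda>b. Poly_Mapping.single b (1 :: 'b)) ` Poly_Mapping.keys y"
    then obtain c d where "a = Poly_Mapping.single c 1" "b = Poly_Mapping.single d 1" by blast
    then have "model_mul a b = model_op c d" by (simp add: pm_mul_single)
    then have "model_mul a b \<in> ?P" by blast
    then show "model_mul a b \<in> pm.span ?P" by (rule pm.span_base)
  qed
  have op0: "model_mul (model_op a b) (model_op c d) = 0" for a b c d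
  proof (cases "(c, d)" rule: model_op.cases)
    case (4 h l)
    then have cd: "model_op c d = bracket h l" by simp
    have 1: "model_mul (Poly_Mapping.single (Inl (x, Some g)) 1) (bracket h l) = 0" for x g
      using cf_swap[of h l g]
      by (simp add: bracket_def[of h l] model.mul_diff_right model.mul_scale_right pm_mul_single
          pm_scale_single op_swap[of g h l] mult.assoc)
    have "model_mul (Poly_Mapping.single (Inl (x, Some g)) k) (bracket h l) = 0" for x g k
      using model.mul_scale_left[of k "Poly_Mapping.single (Inl (x, Some g)) 1" "bracket h l"]
      by (simp add: 1 pm_scale_single)
    then show ?thesis
      by (cases "(a, b)" rule: model_op.cases) (simp_all add: cd model_mul_bracket_bracket)
  qed (simp_all add: model_mul_Inl_right)
  have "model_mul (model_mul x y) (model_mul z w) \<in> pm.span {}"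
    by (rule model.mul_span[OF _ prod prod]) (auto simp: op0)
  then show ?thesis by simp
qed

lemma metabelian_model: "metabelian_leibniz_superalgebra pm_scale model_mul (pm_part model_par)"
proof -
  interpret L: leibniz_superalgebra pm_scale model_mul "pm_part model_par" by (rule leibniz_model)
  show ?thesis by unfold_locales (rule model_mul_metabelian)
qed

end

section \<open>Independence of words\<close>

interpretation words: monomial_superalgebra "(@)" "\<lambda>_ _. 1 :: 'k::field" "word_par :: 'x::super_set list \<Rightarrow> bit"
  by unfold_locales (simp_all only: append_assoc word_par_def map_append sum_list_append)

text \<open>In the model of the free associative algebra, distinct words have distinct basis vectors
  as their \<open>M\<close>-components, each with coefficient 1. The corresponding coordinates
  separate the words.\<close>

lemma NF_basis:
  "inj_on (lb_word :: 'x::super_set list \<Rightarrow> ('x, 'k::field) lb) {w. w \<noteq> []}"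
  "lb.independent (NF :: ('x, 'k) lb set)"
proof -
  let ?gen = "\<lambda>x::'x. [x]"
  \<comment> \<open>A one-letter word gives \<open>x \<otimes> 1\<close> with the adjoined unit
    \<open>None\<close>, which differs from the basis element \<open>Some []\<close>.\<close>
  let ?idx = "\<lambda>w::'x list. (hd w, if tl w = [] then None else Some (tl w))"
  have "(words.model_gen ?gen x :: _ \<Rightarrow>\<^sub>0 'k) \<in> pm_part words.model_par (par x)" for x
    by (rule words.model_gen_part) (simp add: word_par_def)
  from lb_universal[OF words.leibniz_model this]
  obtain H where H: "superalgebra_hom lb_scale lb_mul lb_part pm_scale words.model_mul (pm_part words.model_par)
      (H :: ('x, 'k) lb \<Rightarrow> _)" "\<And>x. H (lb_gen x) = words.model_gen ?gen x"
    by blast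
  have st: "foldl (words.word_step ?gen) (None, 1 :: 'k) v = (if v = [] then None else Some v, 1)" for v
    by (induction v rule: rev_induct) (simp_all add: words.word_step_def)
  have look: "Poly_Mapping.lookup (H (lb_word w)) (Inl (?idx v)) = (if v = w then 1 else 0)"
    if "w \<noteq> []" "v \<noteq> []" for v w
  proof -
    have "H (lb_word w) = left_normed words.model_mul (map (words.model_gen ?gen) (hd w # tl w))"
      using hom_left_normed[OF H(1) that(1), of lb_gen] that(1) by (simp add: H(2))
    then have "Poly_Mapping.lookup (H (lb_word w)) (Inl (?idx v)) =
        (let st = foldl (words.word_step ?gen) (None, 1) (tl w)
         in if ?idx v = (hd w, fst st) then snd st else 0)"
      by (simp only: words.lookup_model_word)
    then show ?thesis using that by (cases v; cases w) (auto simp only: st Let_def list.sel fst_conv snd_conv split: if_splits)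
  qed
  have H_lin: "H (x + y) = H x + H y" "H (lb_scale c x) = pm_scale c (H x)" for x y c
    using H(1) unfolding superalgebra_hom_def by blast+
  note coords = lb.independent_if_coordinates[where I="{w. w \<noteq> []}" and e=lb_word
      and \<phi>="\<lambda>v f. Poly_Mapping.lookup (H f) (Inl (?idx v))"]
  show "inj_on (lb_word :: 'x list \<Rightarrow> ('x, 'k) lb) {w. w \<noteq> []}"
    by (rule coords) (auto simp: look H_lin lookup_add pm_scale.rep_eq simp del: hd_Cons_tl)
  show "lb.independent (NF :: ('x, 'k) lb set)"
    unfolding NF_def
    by (rule coords) (auto simp: look H_lin lookup_add pm_scale.rep_eq)
qed

text \<open>The free supercommutative algebra is the monoid algebra of multisets, twisted by a
  bimultiplicative factor (so associativity is automatic). Away from characteristic 2 the factor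
  vanishes on two equal odd letters; products then never reach a multiset with a repeated odd
  letter, and these multisets may stay in the basis.\<close>

definition twist :: "'x::{linorder,super_set} \<Rightarrow> 'x \<Rightarrow> 'k::field"
  where "twist x y = (if par x * par y = 0 then 1
    else if x = y then (if CHAR('k) = 2 then 1 else 0) else if y < x then - 1 else 1)"

definition mtwist :: "'x::{linorder,super_set} multiset \<Rightarrow> 'x multiset \<Rightarrow> 'k::field"
  where "mtwist s t = (\<Prod>x\<in>#s. \<Prod>y\<in>#t. twist x y)"

definition mset_par :: "'x::super_set multiset \<Rightarrow> bit"
  where "mset_par s = (\<Sum>x\<in>#s. par x)"

lemma mset_par_simps:
  "mset_par {#} = 0" "mset_par (add_mset x s) = par x + mset_par s"
  "mset_par (s + t) = mset_par s + mset_par t"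
  by (simp_all add: mset_par_def del: add_bit_eq_xor)

lemma mtwist_simps:
  "mtwist {#} t = 1" "mtwist s {#} = 1"
  "mtwist (s + s') t = mtwist s t * mtwist s' t"
  "mtwist s (t + t') = mtwist s t * mtwist s t'"
  by (simp_all add: mtwist_def prod_mset.distrib)

lemma mtwist_add_mset:
  "mtwist (add_mset x s) t = mtwist {#x#} t * mtwist s t"
  "mtwist s (add_mset y t) = mtwist s {#y#} * mtwist s t"
  by (simp_all add: mtwist_def prod_mset.distrib)

lemma minus_one_CHAR_2: "CHAR('k::field) = 2 \<Longrightarrow> (- 1 :: 'k) = 1"
  using of_nat_CHAR[where ?'a='k] by (simp add: eq_neg_iff_add_eq_0 one_add_one)

text \<open>The critical case is two equal odd letters, where the sign is -1: either the twist is 0,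
  or the characteristic is 2 and \<open>- 1 = 1\<close>.\<close>

lemma twist_swap: "twist x y = (koszul (par x) (par y) * twist y x :: 'k::field)"
  using minus_one_CHAR_2[where ?'k='k]
  by (auto simp: twist_def koszul_def)

text \<open>Both sides are bimultiplicative in \<open>s\<close> and \<open>t\<close>, which reduces
  the claim to single letters.\<close>

lemma mtwist_swap: "mtwist s t = (koszul (mset_par s) (mset_par t) * mtwist t s :: 'k::field)"
proof (induction s)
  case (add x s)
  have "mtwist {#x#} t = (koszul (par x) (mset_par t) * mtwist t {#x#} :: 'k)"
  proof (induction t)
    case (add y t)
    show ?case
      unfolding mtwist_add_mset(2)[of "{#x#}" y t] mtwist_add_mset(1)[of y t] mset_par_simps koszul_add_right add
      using twist_swap[of x y, where ?'k='k]
      by (simp add: mtwist_def[of "{#_#}" "{#_#}"])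
  qed (simp add: mset_par_simps mtwist_simps koszul_zero)
  then show ?case
    unfolding mtwist_add_mset(1)[of x s] mtwist_add_mset(2)[of t x s] mset_par_simps koszul_add_left add
    by simp
qed (simp add: mset_par_simps mtwist_simps koszul_zero)

definition sym_op :: "'x \<times> 'x multiset \<Rightarrow> 'x \<times> 'x multiset \<Rightarrow> 'x \<times> 'x multiset"
  where "sym_op g h = (fst g, snd g + ({#fst h#} + snd h))"

text \<open>For \<open>g = a \<otimes> s\<close> and \<open>h = b \<otimes> t\<close> this is the
  scalar produced by \<open>s b t\<close> in \<open>S(V)\<close>: the last factor comes from
  \<open>b t\<close>, the first from multiplying the result by \<open>s\<close> on the left.\<close>

definition sym_cf :: "'x::{linorder,super_set} \<times> 'x multiset \<Rightarrow> 'x \<times> 'x multiset \<Rightarrow> 'k::field"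
  where "sym_cf g h = mtwist (snd g) ({#fst h#} + snd h) * mtwist {#fst h#} (snd h)"

definition sym_par :: "'x::super_set \<times> 'x multiset \<Rightarrow> bit"
  where "sym_par g = mset_par ({#fst g#} + snd g)"

interpretation sym: right_supercommutative sym_op
  "sym_cf :: _ \<Rightarrow> _ \<Rightarrow> 'k::field" "sym_par :: 'x::{linorder,super_set} \<times> 'x multiset \<Rightarrow> bit"
proof
  fix g h l :: "'x \<times> 'x multiset"
  show "sym_op (sym_op g h) l = sym_op g (sym_op h l)"
    by (simp add: sym_op_def)
  show "sym_par (sym_op g h) = sym_par g + sym_par h"
    by (simp only: sym_par_def sym_op_def fst_conv snd_conv mset_par_simps ac_simps)
  show "sym_op g (sym_op h l) = sym_op g (sym_op l h)"
    by (simp add: sym_op_def)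
  show "sym_cf g h * sym_cf (sym_op g h) l = (sym_cf h l * sym_cf g (sym_op h l) :: 'k)"
    unfolding sym_cf_def sym_op_def fst_conv snd_conv
    by (simp only: mtwist_simps ac_simps)
  \<comment> \<open>All factors symmetric in \<open>h\<close> and \<open>l\<close> are collected in
    front; only the last one changes under the swap, by \<open>mtwist_swap\<close>.\<close>
  have *: "sym_cf h l * sym_cf g (sym_op h l) =
      (mtwist {#fst h#} (snd h) * mtwist {#fst l#} (snd l) *
       mtwist (snd g) ({#fst h#} + snd h + ({#fst l#} + snd l))) *
      (mtwist ({#fst h#} + snd h) ({#fst l#} + snd l) :: 'k)" for h l
    unfolding sym_cf_def sym_op_def fst_conv snd_conv
    by (simp only: mtwist_simps ac_simps)
  show "sym_cf h l * sym_cf g (sym_op h l) =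
      (koszul (sym_par h) (sym_par l) * (sym_cf l h * sym_cf g (sym_op l h)) :: 'k)"
    unfolding *[of h l] *[of l h] sym_par_def
    unfolding mtwist_swap[of "{#fst h#} + snd h" "{#fst l#} + snd l"] by (simp only: ac_simps)
qed

section \<open>Standard words and their coordinates in the metabelian quotient\<close>

text \<open>The condition on \<open>twist\<close> rules out two equal odd letters exactly when the
  characteristic is not 2, so one notion serves both cases. The type argument fixes the
  field.\<close>

definition standard_pair :: "'k::field itself \<Rightarrow> 'x::{linorder,super_set} \<Rightarrow> 'x \<Rightarrow> bool"
  where "standard_pair _ a b \<longleftrightarrow> a \<le> b \<and> (twist a b :: 'k) \<noteq> 0"

definition standard_words :: "'k::field itself \<Rightarrow> 'x::{linorder,super_set} list set"
  where "standard_words K = {w. w \<noteq> [] \<and> sorted_wrt (standard_pair K) (drop 2 w)}"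

lemma twist_eq_0_iff:
  "(twist a b :: 'k::field) = 0 \<longleftrightarrow> CHAR('k) \<noteq> 2 \<and> a = b \<and> par a = 1"
  by (auto simp: twist_def)

lemma mtwist_eq_0_iff:
  "(mtwist s t :: 'k::field) = 0 \<longleftrightarrow> (\<exists>x\<in>#s. \<exists>y\<in>#t. (twist x y :: 'k) = 0)"
  by (simp add: mtwist_def prod_mset_zero_iff image_iff)

text \<open>In the supercommutative model a standard word \<open>a b u\<close> has as
  \<open>M\<close>-component a nonzero multiple of \<open>a \<otimes> (b \<otimes> u)\<close>, with
  \<open>u\<close> read as a multiset. A sorted list is determined by its multiset, so distinct
  standard words meet distinct basis vectors, and the coordinates at these serve as
  \<open>\<phi>\<close>.\<close>

lemma mlb_coordinates:
  obtains \<phi> :: "'x::{wellorder,super_set} list \<Rightarrow> ('x, 'k::field) mlb \<Rightarrow> 'k"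
  where "\<And>v x y. \<phi> v (x + y) = \<phi> v x + \<phi> v y"
    and "\<And>v c x. \<phi> v (mlb_scale c x) = c * \<phi> v x"
    and "\<And>v. v \<in> standard_words TYPE('k) \<Longrightarrow> \<phi> v (mlb_word v) \<noteq> 0"
    and "\<And>v w. v \<in> standard_words TYPE('k) \<Longrightarrow> w \<in> standard_words TYPE('k) \<Longrightarrow> v \<noteq> w \<Longrightarrow>
      \<phi> v (mlb_word w) = 0"
proof -
  let ?gen = "\<lambda>x::'x. (x, {#})"
  let ?idx = "\<lambda>w::'x list. (hd w, if tl w = [] then None else Some (hd (tl w), mset (drop 2 w)))"
  have "(sym.model_gen ?gen x :: _ \<Rightarrow>\<^sub>0 'k) \<in> pm_part sym.model_par (par x)" for x
    by (rule sym.model_gen_part) (simp add: sym_par_def mset_par_def)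
  from mlb_universal[OF sym.metabelian_model this]
  obtain H where H: "superalgebra_hom mlb_scale mlb_mul mlb_part pm_scale sym.model_mul (pm_part sym.model_par)
      (H :: ('x, 'k) mlb \<Rightarrow> _)" "\<And>x. H (mlb_gen x) = sym.model_gen ?gen x"
    by blast
  have H_lin: "H (x + y) = H x + H y" "H (mlb_scale c x) = pm_scale c (H x)" for x y c
    using H(1) unfolding superalgebra_hom_def by blast+
  let ?st = "foldl (sym.word_step ?gen) (None, 1 :: 'k)"
  have st: "\<exists>k. ?st (b # u) = (Some (b, mset u), k) \<and>
      (sorted_wrt (standard_pair TYPE('k)) u \<longrightarrow> k \<noteq> 0)" for b u
  proof (induction u rule: rev_induct)
    case (snoc x u)
    then obtain k where k: "?st (b # u) = (Some (b, mset u), k)"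
      "sorted_wrt (standard_pair TYPE('k)) u \<longrightarrow> k \<noteq> 0" by blast
    have "?st (b # u @ [x]) = (Some (b, mset (u @ [x])), k * mtwist (mset u) {#x#})"
      using k(1) by (simp add: sym.word_step_def sym_op_def sym_cf_def mtwist_simps)
    \<comment> \<open>The new factor is the product of all \<open>twist y x\<close> with
      \<open>y\<close> in \<open>u\<close>. None of them is 0, because \<open>sorted_wrt\<close>
      relates every earlier letter to \<open>x\<close>, not just the last one.\<close>
    moreover have "k * mtwist (mset u) {#x#} \<noteq> 0"
      if "sorted_wrt (standard_pair TYPE('k)) (u @ [x])"
      using that k(2) by (auto simp: sorted_wrt_append standard_pair_def mtwist_eq_0_iff)
    ultimately show ?case by blast
  qed (simp add: sym.word_step_def)
  have look: "Poly_Mapping.lookup (H (mlb_word w)) (Inl y) =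
      (if y = (hd w, fst (?st (tl w))) then snd (?st (tl w)) else 0)" if "w \<noteq> []" for w y
  proof -
    have "H (mlb_word w) = left_normed sym.model_mul (map (sym.model_gen ?gen) (hd w # tl w))"
      using hom_left_normed[OF H(1) that, of mlb_gen] that by (simp add: H(2))
    then show ?thesis by (simp only: sym.lookup_model_word Let_def)
  qed
  have idx: "fst (?st (tl w)) = snd (?idx w)" "snd (?st (tl w)) \<noteq> 0"
    if "w \<in> standard_words TYPE('k)" for w
  proof -
    have "fst (?st (tl w)) = snd (?idx w) \<and> snd (?st (tl w)) \<noteq> 0"
    proof (cases "tl w")
      case (Cons b u)
      then have "w = hd w # b # u" using that by (cases w) (auto simp: standard_words_def)
      then have "drop 2 w = u" by (metis drop_0 drop_Suc_Cons numeral_2_eq_2)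
      then show ?thesis using st[of b u] that unfolding Cons standard_words_def by auto
    qed simp
    then show "fst (?st (tl w)) = snd (?idx w)" "snd (?st (tl w)) \<noteq> 0" by blast+
  qed
  have inj: "v = w" if "v \<in> standard_words TYPE('k)" "w \<in> standard_words TYPE('k)" "?idx v = ?idx w" for v w
  proof -
    have d: "u \<noteq> [] \<Longrightarrow> u = hd u # (if tl u = [] then [] else hd (tl u) # drop 2 u)" for u :: "'x list"
      by (cases u; cases "tl u") auto
    have srt: "sorted (drop 2 u)" if "u \<in> standard_words TYPE('k)" for u :: "'x list"
      using that by (auto simp: standard_words_def standard_pair_def elim: sorted_wrt_mono_rel[rotated])
    have "mset (drop 2 v) = mset (drop 2 w)" "hd v = hd w" "tl v = [] \<longleftrightarrow> tl w = []"
      "tl v \<noteq> [] \<Longrightarrow> hd (tl v) = hd (tl w)"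
      using that(3) by (auto split: if_splits simp: drop_Suc numeral_2_eq_2)
    moreover from this(1) have "drop 2 v = drop 2 w"
      using srt that(1,2) by (metis properties_for_sort sorted_sort_id)
    ultimately have "hd v # (if tl v = [] then [] else hd (tl v) # drop 2 v) =
        hd w # (if tl w = [] then [] else hd (tl w) # drop 2 w)" by simp
    moreover have "v \<noteq> []" "w \<noteq> []" using that(1,2) by (auto simp: standard_words_def)
    ultimately show ?thesis using d by metis
  qed
  show thesis
  proof
    fix v w :: "'x list" and x y :: "('x, 'k) mlb" and c
    let ?\<phi> = "\<lambda>v x. Poly_Mapping.lookup (H x) (Inl (?idx v))"
    show "?\<phi> v (x + y) = ?\<phi> v x + ?\<phi> v y" "?\<phi> v (mlb_scale c x) = c * ?\<phi> v x"
      by (simp_all add: H_lin lookup_add pm_scale.rep_eq)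
    assume v: "v \<in> standard_words TYPE('k)"
    show "?\<phi> v (mlb_word v) \<noteq> 0"
      using look[of v "?idx v"] idx[OF v] v by (simp add: standard_words_def)
    assume w: "w \<in> standard_words TYPE('k)" "v \<noteq> w"
    then show "?\<phi> v (mlb_word w) = 0"
      using look[of w "?idx v"] idx(1)[OF w(1)] inj[OF v w(1)] by (auto simp: standard_words_def)
  qed
qed

section \<open>Leading monomials\<close>

lemma word_less_wf: "wf {(u, v :: 'x::wellorder list). word_less u v}"
  unfolding word_less_def using wf_lenlex[OF wf] by simp

lemma word_less_asym: "word_less u v \<Longrightarrow> \<not> word_less v (u :: 'x::wellorder list)"
  using wf_asym[OF word_less_wf] by blast

lemma word_less_trans: "word_less u v \<Longrightarrow> word_less v w \<Longrightarrow> word_less u (w :: 'x::wellorder list)"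
  unfolding word_less_def
  by (rule transD[OF lenlex_transI]) (auto intro: transI)

lemma word_less_append: "word_less u v \<Longrightarrow> word_less (u @ w) (v @ w)"
  unfolding word_less_def lenlex_conv by (auto intro: lex_append_rightI)

lemma word_less_swap: "a < b \<Longrightarrow> word_less (cs @ [a, b]) (cs @ [b, a])"
  unfolding word_less_def lenlex_conv by (auto intro!: lex_append_leftI)

lemma word_less_length: "word_less u v \<Longrightarrow> length u \<le> length v"
  unfolding word_less_def lenlex_conv by auto

lemma lb_span_NF: "f \<in> lb.span NF"
  unfolding NF_def span_lb_words by simp

lemma representation_word:
  assumes "v \<noteq> []" "w \<noteq> []"
  shows "lb.representation NF (lb_word v) (lb_word w :: ('x::super_set, 'k::field) lb) = (if v = w then 1 else 0)"
proof -
  have "(lb_word v :: ('x, 'k) lb) \<in> NF" using assms(1) by (auto simp: NF_def)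
  from lb.representation_basis[OF NF_basis(2) this] have "lb.representation NF (lb_word v) (lb_word w :: ('x, 'k) lb) =
      (if lb_word w = (lb_word v :: ('x, 'k) lb) then 1 else 0)"
    by simp
  moreover have "lb_word w = (lb_word v :: ('x, 'k) lb) \<longleftrightarrow> v = w"
    using inj_on_eq_iff[OF NF_basis(1)] assms by blast
  ultimately show ?thesis by simp
qed

lemma representation_span_words:
  fixes f :: "('x::super_set, 'k::field) lb"
  assumes "f \<in> lb.span (lb_word ` W)" "W \<subseteq> {w. w \<noteq> []}" "w \<noteq> []" "w \<notin> W"
  shows "lb.representation NF f (lb_word w) = 0"
  using assms(1)
proof (induction rule: lb.span_induct_alt)
  case base
  then show ?case by (simp add: lb.representation_zero)
next
  case (step c x y)
  then obtain v where "x = lb_word v" "v \<in> W" by blast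
  moreover from this have "v \<noteq> []" "v \<noteq> w" using assms by auto
  ultimately show ?case
    using step.IH assms(3)
    by (simp add: lb.representation_add lb.representation_scale NF_basis(2) lb_span_NF representation_word)
qed

lemma monomials_span_words:
  "f \<in> lb.span (lb_word ` W) \<Longrightarrow> W \<subseteq> {w. w \<noteq> []} \<Longrightarrow> monomials f \<subseteq> W"
  using representation_span_words by (auto simp: monomials_def)

text \<open>The condition \<open>f - lb_word w \<in> lower w\<close> expresses, without
  \<open>THE\<close>, that \<open>f\<close> is monic with leading word \<open>w\<close>.\<close>

definition lower :: "'x::{wellorder,super_set} list \<Rightarrow> ('x, 'k::field) lb set"
  where "lower w = lb.span (lb_word ` {v. v \<noteq> [] \<and> word_less v w})"

lemma lead_eqI:
  fixes f :: "('x::{wellorder,super_set}, 'k::field) lb"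
  assumes "f - lb_word w \<in> lower w" "w \<noteq> []"
  shows "lead f = w" "monic f"
proof -
  let ?R = "\<lambda>f v. lb.representation NF f (lb_word v)"
  have "?R f v = ?R (f - lb_word w) v + ?R (lb_word w) v" for v
    using lb.representation_add[OF NF_basis(2) lb_span_NF lb_span_NF, of "f - lb_word w" "lb_word w"]
    by simp
  moreover have "?R (f - lb_word w) v = 0" if "v \<noteq> []" "\<not> word_less v w" for v
    using assms that unfolding lower_def by (intro representation_span_words) auto
  ultimately have R: "?R f v = (if v = w then 1 else 0)" if "v \<noteq> []" "\<not> word_less v w" for v
    using that assms(2) by (auto simp: representation_word)
  have irr: "\<not> word_less w w" using word_less_asym by blast
  have mono: "w \<in> monomials f" "\<And>v. v \<in> monomials f \<Longrightarrow> v \<noteq> w \<Longrightarrow> word_less v w"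
    using R irr assms(2) by (force simp: monomials_def)+
  show l: "lead f = w"
    unfolding lead_def
  proof (rule the_equality)
    show "w \<in> monomials f \<and> (\<forall>v\<in>monomials f. v \<noteq> w \<longrightarrow> word_less v w)"
      using mono by simp
    fix u assume "u \<in> monomials f \<and> (\<forall>v\<in>monomials f. v \<noteq> u \<longrightarrow> word_less v u)"
    then show "u = w" using mono word_less_asym by metis
  qed
  have "f \<noteq> 0" using mono(1) by (auto simp: monomials_def lb.representation_zero)
  then show "monic f" using R[OF assms(2) irr] by (simp add: monic_def l)
qed

lemma lower_mul_gen:
  fixes f :: "('x::{wellorder,super_set}, 'k::field) lb"
  assumes "f \<in> lower w"
  shows "lb_mul f (lb_gen a) \<in> lower (w @ [a])"
  unfolding lower_def
proof (rule lb.mul_span[OF _ assms[unfolded lower_def]])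
  show "lb_gen a \<in> lb.span {lb_gen a}" by (rule lb.span_base) simp
  fix x y :: "('x, 'k) lb" assume "x \<in> lb_word ` {v. v \<noteq> [] \<and> word_less v w}" "y \<in> {lb_gen a}"
  then obtain v where v: "x = lb_word v" "y = lb_gen a" "v \<noteq> []" "word_less v w" by blast
  have "lb_mul x y = lb_word (v @ [a])" unfolding v(1,2) by (rule lb_word_snoc[OF v(3), symmetric])
  then show "lb_mul x y \<in> lb.span (lb_word ` {v. v \<noteq> [] \<and> word_less v (w @ [a])})"
    using v(4) word_less_append by (auto intro!: lb.span_base imageI simp del: map_append)
qed

text \<open>Appending a letter preserves the strict word order, so right multiplication by
  generators only appends letters to the leading word.\<close>

lemma left_normed_word_lower:
  assumes "s - lb_word w \<in> lower w" "w \<noteq> []"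
  shows "left_normed lb_mul (s # map lb_gen as) - lb_word (w @ as) \<in> lower (w @ as)"
proof (induction as rule: rev_induct)
  case (snoc a as)
  have "left_normed lb_mul (s # map lb_gen (as @ [a])) - lb_word (w @ as @ [a]) =
      lb_mul (left_normed lb_mul (s # map lb_gen as) - lb_word (w @ as)) (lb_gen a)"
    using left_normed_snoc[of "s # map lb_gen as" lb_mul "lb_gen a"] lb_word_snoc[of "w @ as" a] assms(2)
    by (simp add: lb.mul_diff_left)
  then show ?case using lower_mul_gen[OF snoc, of a] by simp
qed (use assms in \<open>simp add: left_normed_single\<close>)

lemma abs_mlb_hom: "superalgebra_hom lb_scale lb_mul lb_part mlb_scale mlb_mul mlb_part abs_mlb"
  by (auto simp: superalgebra_hom_def plus_mlb.abs_eq mlb_scale.abs_eq mlb_mul.abs_eq mlb_part_def)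

lemma abs_mlb_lin:
  "abs_mlb (x + y) = abs_mlb x + abs_mlb y" "abs_mlb (x - y) = abs_mlb x - abs_mlb y"
  "abs_mlb (lb_scale c x) = mlb_scale c (abs_mlb x)" "abs_mlb (lb_mul x y) = mlb_mul (abs_mlb x) (abs_mlb y)"
  by (simp_all add: plus_mlb.abs_eq minus_mlb.abs_eq mlb_scale.abs_eq mlb_mul.abs_eq)

lemma abs_mlb_word: "w \<noteq> [] \<Longrightarrow> abs_mlb (lb_word w) = mlb_word w"
  using hom_left_normed[OF abs_mlb_hom, of w lb_gen] by (simp flip: mlb_gen.abs_eq)

section \<open>Reduction to irreducible words\<close>

text \<open>What both characteristics share: elements of \<open>S\<close> vanish in the quotient,
  every word outside \<open>I\<close> begins with a leading word of \<open>S\<close>, and the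
  functionals \<open>\<phi>\<close> separate the words of \<open>I\<close> in the quotient.\<close>

locale reduction_system =
  fixes S :: "('x::{wellorder,super_set}, 'k::field) lb set" and I :: "'x list set"
    and \<phi> :: "'x list \<Rightarrow> ('x, 'k) mlb \<Rightarrow> 'k"
  assumes S_lead: "s \<in> S \<Longrightarrow> \<exists>w. length w > 1 \<and> s - lb_word w \<in> lower w"
    and S_homogeneous: "s \<in> S \<Longrightarrow> homogeneous s"
    and S_zero: "s \<in> S \<Longrightarrow> abs_mlb s = 0"
    and I_nonempty: "w \<in> I \<Longrightarrow> w \<noteq> []"
    and reducible: "w \<noteq> [] \<Longrightarrow> w \<notin> I \<Longrightarrow> \<exists>s\<in>S. \<exists>as. w = lead s @ as"
    and \<phi>_add: "\<phi> v (x + y) = \<phi> v x + \<phi> v y"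
    and \<phi>_scale: "\<phi> v (mlb_scale c x) = c * \<phi> v x"
    and \<phi>_diag: "v \<in> I \<Longrightarrow> \<phi> v (mlb_word v) \<noteq> 0"
    and \<phi>_off: "v \<in> I \<Longrightarrow> w \<in> I \<Longrightarrow> v \<noteq> w \<Longrightarrow> \<phi> v (mlb_word w) = 0"
begin

lemma S_leadD:
  assumes "s \<in> S"
  shows "length (lead s) > 1" "s - lb_word (lead s) \<in> lower (lead s)" "monic s"
proof -
  obtain w where w: "length w > 1" "s - lb_word w \<in> lower w" using S_lead[OF assms] by blast
  then have "w \<noteq> []" by auto
  from lead_eqI[OF w(2) this] w show "length (lead s) > 1" "s - lb_word (lead s) \<in> lower (lead s)" "monic s"
    by simp_all
qed

lemma normal_polyD:
  assumes "s \<in> S" "normal_poly s h"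
  shows "h - lb_word (lead h) \<in> lower (lead h)" "abs_mlb h = 0"
proof -
  \<comment> \<open>Leading words of \<open>S\<close> have more than one letter, which excludes
    normal polynomials of the second form.\<close>
  obtain as where h: "h = left_normed lb_mul (s # map lb_gen as)"
    using assms S_leadD(1)[OF assms(1)] unfolding normal_poly_def by auto
  have ne: "lead s \<noteq> []" using S_leadD(1)[OF assms(1)] by auto
  have "h - lb_word (lead s @ as) \<in> lower (lead s @ as)"
    unfolding h by (rule left_normed_word_lower[OF S_leadD(2)[OF assms(1)] ne])
  then show "h - lb_word (lead h) \<in> lower (lead h)"
    using lead_eqI(1)[of h "lead s @ as"] ne by simp
  have "abs_mlb (left_normed lb_mul (s # map lb_gen as)) = 0"
  proof (induction as rule: rev_induct)
    case (snoc a as)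
    then show ?case
      using left_normed_snoc[of "s # map lb_gen as" lb_mul "lb_gen a"] by (simp add: abs_mlb_lin)
  qed (simp add: left_normed_single S_zero[OF assms(1)])
  then show "abs_mlb h = 0" unfolding h .
qed

text \<open>The downward closed set \<open>D\<close> bounds the leading words in use. A word
  \<open>lead s @ as\<close> differs from a normal polynomial with that leading word by smaller
  words, and these reduce by well-founded induction.\<close>

lemma word_reduces:
  assumes D: "\<And>u v. v \<in> D \<Longrightarrow> word_less u v \<Longrightarrow> u \<in> D"
  shows "w \<in> D \<Longrightarrow> w \<noteq> [] \<Longrightarrow>
    (lb_word w :: ('x, 'k) lb) \<in> lb.span ({h. \<exists>s\<in>S. normal_poly s h \<and> lead h \<in> D} \<union> lb_word ` I)"
proof (induction w rule: wf_induct_rule[OF word_less_wf])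
  case (1 w)
  let ?T = "{h. \<exists>s\<in>S. normal_poly s h \<and> lead h \<in> D} \<union> lb_word ` I"
  show ?case
  proof (cases "w \<in> I")
    case True
    then show ?thesis by (intro lb.span_base) simp
  next
    case False
    obtain s as where s: "s \<in> S" "w = lead s @ as" using reducible[OF 1(3) False] by blast
    define h where "h = left_normed lb_mul (s # map lb_gen as)"
    have n: "normal_poly s h" unfolding normal_poly_def h_def by blast
    have ne: "lead s \<noteq> []" using S_leadD(1)[OF s(1)] by auto
    have low: "h - lb_word w \<in> lower w"
      unfolding h_def s(2) by (rule left_normed_word_lower[OF S_leadD(2)[OF s(1)] ne])
    then have "lead h = w" using lead_eqI(1)[OF _ 1(3)] by blast
    then have hT: "h \<in> lb.span ?T" using s(1) n 1(2) by (intro lb.span_base) blast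
    have "lb_word ` {v. v \<noteq> [] \<and> word_less v w} \<subseteq> lb.span ?T"
      using 1(1,2) D by blast
    then have "lower w \<subseteq> lb.span ?T"
      unfolding lower_def by (rule lb.span_minimal) (rule lb.subspace_span)
    from lb.span_diff[OF hT subsetD[OF this low]] show ?thesis by simp
  qed
qed

text \<open>Reduction splits \<open>f\<close> into normal polynomials and irreducible words. The
  former vanish in the quotient, so the irreducible part vanishes there too and is zero by the
  functionals \<open>\<phi>\<close>.\<close>

lemma trivial_if_abs_mlb_zero:
  assumes D: "\<And>u v. v \<in> D \<Longrightarrow> word_less u v \<Longrightarrow> u \<in> D"
    and f: "f \<in> lb.span (lb_word ` {w \<in> D. w \<noteq> []})" "abs_mlb f = 0"
  shows "f \<in> lb.span {h. \<exists>s\<in>S. normal_poly s h \<and> lead h \<in> D}"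
proof -
  let ?N = "{h. \<exists>s\<in>S. normal_poly s h \<and> lead h \<in> D}"
  have "lb.span (lb_word ` {w \<in> D. w \<noteq> []}) \<subseteq> lb.span (?N \<union> lb_word ` I)"
    by (rule lb.span_minimal[OF image_subsetI lb.subspace_span]) (use word_reduces[OF D] in simp)
  then obtain t r where tr: "f = t + r" "t \<in> lb.span ?N" "r \<in> lb.span (lb_word ` I)"
    using f(1) unfolding lb.span_Un by blast
  have "abs_mlb t = 0"
    using tr(2) by (induction rule: lb.span_induct_alt)
      (auto simp: abs_mlb_lin normal_polyD zero_mlb_def[symmetric])
  then have r0: "abs_mlb r = 0" using f(2) tr(1) by (simp add: abs_mlb_lin)
  have \<phi>0: "\<phi> v 0 = 0" for v using \<phi>_scale[of v 0 0] by simp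
  have "r = 0"
    by (rule lb.independent_if_coordinates(3)[where e=lb_word and I=I and \<phi>="\<lambda>v f. \<phi> v (abs_mlb f)", OF _ _ _ _ tr(3)])
      (auto simp: abs_mlb_lin \<phi>_add \<phi>_scale \<phi>_diag \<phi>_off I_nonempty abs_mlb_word r0 \<phi>0)
  then show ?thesis using tr by simp
qed

text \<open>Both kinds of compositions vanish in the metabelian quotient, so the preceding lemma
  applies, with \<open>D\<close> the words below \<open>lead f\<close> or the words of bounded
  length.\<close>

theorem GS_basis_S: "GS_basis S"
  unfolding GS_basis_def
proof (intro conjI ballI allI impI)
  fix s assume "s \<in> S"
  then show "monic s" "homogeneous s" using S_leadD(3) S_homogeneous by blast+
next
  fix f g h assume S: "f \<in> S" "g \<in> S" and *: "f \<noteq> g \<and> normal_poly g h \<and> lead f = lead h"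
  \<comment> \<open>Both polynomials are monic, so the common leading word cancels.\<close>
  have "f - h \<in> lower (lead f)"
  proof -
    have "(f - lb_word (lead f)) - (h - lb_word (lead f)) \<in> lower (lead f)"
      using S_leadD(2)[OF S(1)] normal_polyD(1)[OF S(2), of h] * unfolding lower_def
      by (intro lb.span_diff[of "f - lb_word (lead f)"]) auto
    then show ?thesis by simp
  qed
  moreover have "abs_mlb (f - h) = 0"
    using normal_polyD(2)[OF S(2)] * S_zero[OF S(1)] by (simp add: abs_mlb_lin)
  ultimately show "trivial_below S (lead f) (f - h)"
    using trivial_if_abs_mlb_zero[of "{v. word_less v (lead f)}" "f - h"] word_less_trans
    unfolding trivial_below_def lower_def by (simp add: conj_commute) blast
next
  fix f \<mu> assume f: "f \<in> S" and \<mu>: "\<mu> \<noteq> [] \<and> lb_mul (lb_word \<mu>) f \<noteq> 0"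
  let ?n = "length \<mu> + length (lead f)"
  have ne: "lead f \<noteq> []" using S_leadD(1)[OF f] by auto
  \<comment> \<open>Smaller words are not longer, so \<open>f\<close> lies in the span of
    \<open>?W\<close>; as multiplication of words adds lengths, this yields the degree
    bound.\<close>
  let ?W = "lb_word ` {v. v \<noteq> [] \<and> length v \<le> length (lead f)} :: ('x, 'k) lb set"
  have "(f - lb_word (lead f)) + lb_word (lead f) \<in> lb.span ?W"
  proof (rule lb.span_add)
    have "lower (lead f) \<subseteq> lb.span ?W"
      unfolding lower_def by (intro lb.span_mono image_mono) (use word_less_length in auto)
    then show "f - lb_word (lead f) \<in> lb.span ?W" using S_leadD(2)[OF f] by blast
    show "lb_word (lead f) \<in> lb.span ?W" using ne by (intro lb.span_base imageI) simp
  qed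
  then have fW: "f \<in> lb.span ?W" by simp
  have "lb_mul (lb_word \<mu>) f \<in> lb.span (lb_word ` {w \<in> {v. length v \<le> ?n}. w \<noteq> []})"
  proof (rule lb.mul_span[OF _ _ fW])
    show "lb_word \<mu> \<in> lb.span {lb_word \<mu>}" by (rule lb.span_base) simp
    fix x y :: "('x, 'k) lb" assume "x \<in> {lb_word \<mu>}" "y \<in> ?W"
    then obtain v where v: "x = lb_word \<mu>" "y = lb_word v" "v \<noteq> []" "length v \<le> length (lead f)" by blast
    have "lb_mul x y \<in> lb.span (lb_word ` {w. length w = length \<mu> + length v})"
      unfolding v using \<mu> v(3) by (intro lb_word_mul) auto
    also have "\<dots> \<subseteq> lb.span (lb_word ` {w \<in> {v. length v \<le> ?n}. w \<noteq> []})"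
      using v by (intro lb.span_mono image_mono) auto
    finally show "lb_mul x y \<in> lb.span (lb_word ` {w \<in> {v. length v \<le> ?n}. w \<noteq> []})" .
  qed
  moreover have "abs_mlb (lb_mul (lb_word \<mu>) f) = 0" by (simp add: abs_mlb_lin S_zero[OF f])
  ultimately have "lb_mul (lb_word \<mu>) f \<in>
      lb.span {h. \<exists>s\<in>S. normal_poly s h \<and> lead h \<in> {v. length v \<le> ?n}}"
    by (intro trivial_if_abs_mlb_zero) (use word_less_length in force)+
  then show "trivial_deg S ?n (lb_mul (lb_word \<mu>) f)"
    unfolding trivial_deg_def by simp
qed

theorem mlb_basis_I: "mlb.basis_family (mlb_word :: 'x list \<Rightarrow> ('x, 'k) mlb) I"
  unfolding mlb.basis_family_def
proof (intro conjI)
  show "inj_on (mlb_word :: 'x list \<Rightarrow> ('x, 'k) mlb) I"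
    by (rule mlb.independent_if_coordinates(1)[where \<phi>=\<phi>]) (simp_all add: \<phi>_add \<phi>_scale \<phi>_diag \<phi>_off)
  show "mlb.independent (mlb_word ` I :: ('x, 'k) mlb set)"
    by (rule mlb.independent_if_coordinates(2)[where \<phi>=\<phi>]) (simp_all add: \<phi>_add \<phi>_scale \<phi>_diag \<phi>_off)
  let ?N = "{h. \<exists>s\<in>S. normal_poly s h \<and> lead h \<in> UNIV}"
  have "x \<in> mlb.span (mlb_word ` I)" for x :: "('x, 'k) mlb"
  proof -
    obtain f where x: "x = abs_mlb f" using abs_mlb_ex by blast
    have "lb.span (lb_word ` {w. w \<noteq> []}) \<subseteq> lb.span (?N \<union> lb_word ` I)"
      by (rule lb.span_minimal[OF image_subsetI lb.subspace_span]) (use word_reduces[of UNIV] in simp)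
    then have "f \<in> lb.span (?N \<union> lb_word ` I)" unfolding span_lb_words by blast
    then have "abs_mlb f \<in> mlb.span (mlb_word ` I)"
    proof (induction rule: lb.span_induct_alt)
      case base
      show ?case by (simp add: zero_mlb_def[symmetric] mlb.span_zero)
    next
      case (step c g f)
      then have "abs_mlb g \<in> mlb.span (mlb_word ` I)"
        by (auto simp: normal_polyD mlb.span_zero abs_mlb_word I_nonempty intro: mlb.span_base)
      then show ?case using step.IH by (simp add: abs_mlb_lin mlb.span_add mlb.span_scale)
    qed
    then show ?thesis unfolding x .
  qed
  then show "mlb.span (mlb_word ` I) = (UNIV :: ('x, 'k) mlb set)" by blast
qed

end

section \<open>The relations of the free metabelian Leibniz superalgebra\<close>

text \<open>As \<open>length cs \<ge> 2\<close>, the prefix \<open>c\<close> is itself a product, so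
  \<open>c (a b) = 0\<close>. The Leibniz identity expands this into \<open>(c a) b\<close> minus
  the signed \<open>(c b) a\<close>.\<close>

lemma mlb_word_append_swap:
  assumes "length cs \<ge> 2"
  shows "mlb_word (cs @ [a, b]) =
    mlb_scale (koszul (par a) (par b)) (mlb_word (cs @ [b, a]) :: ('x::super_set, 'k::field) mlb)"
proof -
  let ?c = "mlb_word cs :: ('x, 'k) mlb"
  have gen: "(mlb_gen x :: ('x, 'k) mlb) \<in> mlb_part (par x)" for x
    unfolding mlb_part_def mlb_gen.abs_eq using lb_gen_part by (rule imageI)
  have cs: "cs = butlast cs @ [last cs]" "butlast cs \<noteq> []" "cs \<noteq> []"
    using assms by (auto simp flip: length_greater_0_conv)
  have c: "?c \<in> mlb_part (word_par cs)"
    unfolding mlb_part_def abs_mlb_word[OF cs(3), symmetric] using lb_word_part[OF cs(3)] by (rule imageI)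
  have snoc: "mlb_word (cs @ [x, y]) = mlb_mul (mlb_mul ?c (mlb_gen x)) (mlb_gen y)" for x y
    using left_normed_snoc[of "map mlb_gen (cs @ [x])" mlb_mul "mlb_gen y :: ('x, 'k) mlb"]
      left_normed_snoc[of "map mlb_gen cs" mlb_mul "mlb_gen x :: ('x, 'k) mlb"] cs(3) by simp
  have "?c = mlb_mul (mlb_word (butlast cs)) (mlb_gen (last cs))"
    by (subst cs(1)) (use cs(2) in \<open>simp add: left_normed_snoc\<close>)
  then have "mlb_mul ?c (mlb_mul (mlb_gen a) (mlb_gen b)) = 0" by (simp add: mlb.metabelian)
  then show ?thesis
    unfolding snoc using mlb.leibniz[OF c gen[of a] gen[of b]] by (simp add: koszul_commute[of "par b"])
qed

lemma two_neq_0_if_CHAR: "CHAR('k::field) \<noteq> 2 \<Longrightarrow> (2 :: 'k) \<noteq> 0"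
proof
  assume "CHAR('k) \<noteq> 2" "(2 :: 'k) = 0"
  then have "CHAR('k) dvd 2" using of_nat_eq_0_iff_char_dvd[of 2, where ?'a='k] by simp
  then have "CHAR('k) \<le> 2" "CHAR('k) \<noteq> 0" by (auto dest: dvd_imp_le intro!: Nat.gr0I)
  then have "CHAR('k) = 1" using \<open>CHAR('k) \<noteq> 2\<close> by linarith
  then show False using of_nat_CHAR[where ?'a='k] by simp
qed

text \<open>Swapping the two equal odd letters gives \<open>w = - w\<close>, and 2 is
  invertible.\<close>

lemma mlb_word_odd_square:
  assumes "length cs \<ge> 2" "par a = 1" "CHAR('k::field) \<noteq> 2"
  shows "mlb_word (cs @ [a, a]) = (0 :: ('x::super_set, 'k) mlb)"
proof -
  let ?w = "mlb_word (cs @ [a, a]) :: ('x, 'k) mlb"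
  have "?w = - ?w"
    using mlb_word_append_swap[OF assms(1), of a a, where ?'k='k] assms(2)
    by (simp add: koszul_def)
  then have "mlb_scale 2 ?w = 0"
    using mlb.scale_left_distrib[of 1 1 ?w] by (simp add: eq_neg_iff_add_eq_0)
  then show ?thesis using two_neq_0_if_CHAR[OF assms(3)] by simp
qed

lemma word_par_swap: "word_par (cs @ [a, b]) = word_par (cs @ [b, a])"
  by (simp only: word_par_def map_append list.map sum_list_append sum_list.Cons sum_list.Nil ac_simps)

text \<open>The swapped word has the same parity and is smaller because \<open>b < a\<close>; the
  relation itself is \<open>mlb_word_append_swap\<close>.\<close>

lemma S1_properties:
  fixes s :: "('x::{wellorder,super_set}, 'k::field) lb"
  assumes "length cs \<ge> 2" "b < a"
    and s: "s = lb_word (cs @ [a, b]) - lb_scale (koszul (par a) (par b)) (lb_word (cs @ [b, a]))"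
  shows "s - lb_word (cs @ [a, b]) \<in> lower (cs @ [a, b])" "homogeneous s" "abs_mlb s = 0"
proof -
  have "(lb_word (cs @ [b, a]) :: ('x, 'k) lb) \<in> lower (cs @ [a, b])"
    unfolding lower_def using word_less_swap[OF assms(2)] by (intro lb.span_base imageI) simp
  then have "- lb_scale (koszul (par a) (par b)) (lb_word (cs @ [b, a]) :: ('x, 'k) lb) \<in> lower (cs @ [a, b])"
    unfolding lower_def by (intro lb.span_neg lb.span_scale)
  then show "s - lb_word (cs @ [a, b]) \<in> lower (cs @ [a, b])" by (simp add: s)
  have "s \<in> lb.span (lb_word ` {cs @ [a, b], cs @ [b, a]})"
    unfolding s by (intro lb.span_diff lb.span_scale lb.span_base imageI) simp_all
  then have "monomials s \<subseteq> {cs @ [a, b], cs @ [b, a]}" by (rule monomials_span_words) simp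
  then show "homogeneous s"
    unfolding homogeneous_def using word_par_swap[of cs a b] by (intro exI[of _ "word_par (cs @ [a, b])"]) auto
  have "abs_mlb (lb_word (cs @ [x, y]) :: ('x, 'k) lb) = mlb_word (cs @ [x, y])" for x y
    by (rule abs_mlb_word) simp
  then show "abs_mlb s = 0"
    unfolding s abs_mlb_lin using mlb_word_append_swap[OF assms(1), of a b, where ?'k='k] by simp
qed

lemma S2_properties:
  fixes s :: "('x::{wellorder,super_set}, 'k::field) lb"
  assumes "length cs \<ge> 2" "par a = 1" "CHAR('k) \<noteq> 2" and s: "s = lb_word (cs @ [a, a])"
  shows "s - lb_word (cs @ [a, a]) \<in> lower (cs @ [a, a])" "homogeneous s" "abs_mlb s = 0"
proof -
  show "s - lb_word (cs @ [a, a]) \<in> lower (cs @ [a, a])" by (simp add: s lower_def lb.span_zero)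
  have "s \<in> lb.span (lb_word ` {cs @ [a, a]})"
    unfolding s by (intro lb.span_base imageI) simp_all
  then have "monomials s \<subseteq> {cs @ [a, a]}" by (rule monomials_span_words) simp
  then show "homogeneous s" unfolding homogeneous_def by auto
  have "abs_mlb (lb_word (cs @ [a, a]) :: ('x, 'k) lb) = mlb_word (cs @ [a, a])"
    by (rule abs_mlb_word) simp
  then show "abs_mlb s = 0" unfolding s using mlb_word_odd_square[OF assms(1-3)] by simp
qed

text \<open>If \<open>a \<le> b \<le> c\<close> and \<open>twist a c = 0\<close>, then
  \<open>a = c\<close>, hence \<open>a = b\<close>, and \<open>twist a b\<close> is already
  0.\<close>

lemma transp_standard_pair: "transp (standard_pair K :: 'x::{linorder,super_set} \<Rightarrow> _)"
  by (rule transpI) (auto simp: standard_pair_def twist_eq_0_iff)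

text \<open>By transitivity adjacent letters suffice. Indices start at 0, so
  \<open>2 \<le> j\<close> means from the third letter on.\<close>

lemma standard_words_iff:
  "w \<in> standard_words K \<longleftrightarrow> w \<noteq> [] \<and>
    (\<forall>j. 2 \<le> j \<and> j + 1 < length w \<longrightarrow> standard_pair K (w ! j) (w ! (j + 1)))"
proof -
  have "sorted_wrt (standard_pair K) (drop 2 w) \<longleftrightarrow>
      (\<forall>i. Suc i < length (drop 2 w) \<longrightarrow> standard_pair K (drop 2 w ! i) (drop 2 w ! Suc i))"
    by (rule sorted_wrt_iff_nth_Suc_transp[OF transp_standard_pair])
  also have "\<dots> \<longleftrightarrow> (\<forall>i. i + 3 < length w \<longrightarrow> standard_pair K (w ! (i + 2)) (w ! (i + 3)))"
    by (auto simp: add.commute numeral_3_eq_3 numeral_2_eq_2 less_diff_conv)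
  also have "\<dots> \<longleftrightarrow> (\<forall>j. 2 \<le> j \<and> j + 1 < length w \<longrightarrow> standard_pair K (w ! j) (w ! (j + 1)))"
  proof safe
    fix j assume "\<forall>i. i + 3 < length w \<longrightarrow> standard_pair K (w ! (i + 2)) (w ! (i + 3))"
      "2 \<le> j" "j + 1 < length w"
    then show "standard_pair K (w ! j) (w ! (j + 1))"
      by (auto dest!: spec[of _ "j - 2"] simp: numeral_3_eq_3 numeral_2_eq_2 Suc_diff_Suc)
  next
    fix i assume "\<forall>j. 2 \<le> j \<and> j + 1 < length w \<longrightarrow> standard_pair K (w ! j) (w ! (j + 1))"
      "i + 3 < length w"
    then show "standard_pair K (w ! (i + 2)) (w ! (i + 3))"
      by (auto dest!: spec[of _ "i + 2"] simp: numeral_3_eq_3)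
  qed
  finally show ?thesis by (simp add: standard_words_def)
qed

text \<open>Exhibits the prefix \<open>cs @ [a, b]\<close>, which is the leading word of an element
  of \<open>S1\<close> or \<open>S2\<close>.\<close>

lemma nonstandard_split:
  assumes "w \<noteq> []" "w \<notin> standard_words K"
  obtains cs a b as where "w = cs @ [a, b] @ as" "length cs \<ge> 2" "\<not> standard_pair K a b"
proof -
  obtain j where j: "2 \<le> j" "j + 1 < length w" "\<not> standard_pair K (w ! j) (w ! (j + 1))"
    using assms standard_words_iff by blast
  have "w = take j w @ [w ! j, w ! (j + 1)] @ drop (j + 2) w"
    using j(2) by (simp add: Cons_nth_drop_Suc)
  then show thesis using that[of "take j w" "w ! j" "w ! (j + 1)" "drop (j + 2) w"] j by simp
qed

lemma GS_basis_and_mlb_basis: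
  fixes S :: "('x::{wellorder,super_set}, 'k::field) lb set"
  assumes S: "S = (if CHAR('k) = 2 then S1 else S1 \<union> S2)"
  shows "GS_basis S"
    and "mlb.basis_family (mlb_word :: 'x list \<Rightarrow> ('x, 'k) mlb) (standard_words TYPE('k))"
proof -
  obtain \<phi> :: "'x list \<Rightarrow> ('x, 'k) mlb \<Rightarrow> 'k"
    where \<phi>: "\<And>v x y. \<phi> v (x + y) = \<phi> v x + \<phi> v y"
    "\<And>v c x. \<phi> v (mlb_scale c x) = c * \<phi> v x"
    "\<And>v. v \<in> standard_words TYPE('k) \<Longrightarrow> \<phi> v (mlb_word v) \<noteq> 0"
    "\<And>v w. v \<in> standard_words TYPE('k) \<Longrightarrow> w \<in> standard_words TYPE('k) \<Longrightarrow> v \<noteq> w \<Longrightarrow>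
      \<phi> v (mlb_word w) = 0"
    using mlb_coordinates[where ?'x='x and ?'k='k] by metis
  have S_cases: "(\<exists>cs a b. length cs \<ge> 2 \<and> b < a \<and>
      s = lb_word (cs @ [a, b]) - lb_scale (koszul (par a) (par b)) (lb_word (cs @ [b, a]))) \<or>
    (\<exists>cs a. length cs \<ge> 2 \<and> par a = 1 \<and> CHAR('k) \<noteq> 2 \<and> s = lb_word (cs @ [a, a]))"
    if "s \<in> S" for s
    using that unfolding S S1_def S2_def by (auto split: if_splits)
  have props: "\<exists>cs a b. s - lb_word (cs @ [a, b]) \<in> lower (cs @ [a, b])" "homogeneous s" "abs_mlb s = 0"
    if "s \<in> S" for s
    using S_cases[OF that] S1_properties[where s=s] S2_properties[where s=s] by blast+
  interpret reduction_system S "standard_words TYPE('k)" \<phi>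
  proof
    fix s assume s: "s \<in> S"
    obtain cs a b where "s - lb_word (cs @ [a, b]) \<in> lower (cs @ [a, b])" using props(1)[OF s] by blast
    then show "\<exists>w. length w > 1 \<and> s - lb_word w \<in> lower w" by (intro exI[of _ "cs @ [a, b]"]) simp
    show "homogeneous s" "abs_mlb s = 0" using props[OF s] by blast+
  next
    fix w :: "'x list" assume "w \<noteq> []" "w \<notin> standard_words TYPE('k)"
    then obtain cs a b as where w: "w = cs @ [a, b] @ as" "length cs \<ge> 2"
      "\<not> standard_pair TYPE('k) a b" by (rule nonstandard_split)
    \<comment> \<open>A pair that is not standard is either a descent, covered by \<open>S1\<close>,
      or a repeated odd letter outside characteristic 2, covered by \<open>S2\<close>.\<close>
    have "\<exists>s\<in>S. lead s = cs @ [a, b]"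
    proof (cases "b < a")
      case True
      define s :: "('x, 'k) lb"
        where "s = lb_word (cs @ [a, b]) - lb_scale (koszul (par a) (par b)) (lb_word (cs @ [b, a]))"
      have "s \<in> S1" unfolding S1_def s_def using w(2) True by blast
      then have "s \<in> S" by (simp add: S)
      moreover have "lead s = cs @ [a, b]"
        by (rule lead_eqI(1)[OF S1_properties(1)[OF w(2) True s_def]]) simp
      ultimately show ?thesis by blast
    next
      case False
      then have ab: "CHAR('k) \<noteq> 2" "a = b" "par a = 1"
        using w(3) unfolding standard_pair_def twist_eq_0_iff by auto
      have "(lb_word (cs @ [a, a]) :: ('x, 'k) lb) \<in> S2" unfolding S2_def using w(2) ab by blast
      then have "(lb_word (cs @ [a, a]) :: ('x, 'k) lb) \<in> S" using ab(1) by (simp add: S)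
      moreover have "lead (lb_word (cs @ [a, a]) :: ('x, 'k) lb) = cs @ [a, a]"
        by (rule lead_eqI(1)[OF S2_properties(1)[OF w(2) ab(3,1) refl]]) simp
      ultimately show ?thesis using ab(2) by blast
    qed
    then show "\<exists>s\<in>S. \<exists>as. w = lead s @ as" using w(1) by (metis append.assoc)
  qed (use \<phi> in \<open>auto simp: standard_words_def\<close>)
  show "GS_basis S" by (rule GS_basis_S)
  show "mlb.basis_family (mlb_word :: 'x list \<Rightarrow> ('x, 'k) mlb) (standard_words TYPE('k))"
    by (rule mlb_basis_I)
qed

theorem theorem5p5:
  shows "(CHAR('k::field) = 2 \<longrightarrow>
      GS_basis (S1 :: ('x::{wellorder,super_set}, 'k) lb set) \<and>
      mlb.basis_family (mlb_word :: 'x list \<Rightarrow> ('x, 'k) mlb)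
        {w. w \<noteq> [] \<and> sorted (drop 2 w)}) \<and>
    (CHAR('k) \<noteq> 2 \<longrightarrow>
      GS_basis (S1 \<union> S2 :: ('x, 'k) lb set) \<and>
      mlb.basis_family (mlb_word :: 'x list \<Rightarrow> ('x, 'k) mlb)
        {w. w \<noteq> [] \<and> sorted (drop 2 w) \<and>
          (\<forall>j. 2 \<le> j \<and> j + 1 < length w \<and> par (w ! j) = 1 \<longrightarrow> w ! j \<noteq> w ! (j + 1))})"
proof (intro conjI impI)
  assume 2: "CHAR('k) = 2"
  show "GS_basis (S1 :: ('x, 'k) lb set)"
    by (rule GS_basis_and_mlb_basis(1)) (simp add: 2)
  \<comment> \<open>In characteristic 2 the twist never vanishes.\<close>
  have "standard_pair TYPE('k) = ((\<le>) :: 'x \<Rightarrow> _)"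
    by (intro ext) (simp add: standard_pair_def twist_eq_0_iff 2)
  then show "mlb.basis_family (mlb_word :: 'x list \<Rightarrow> ('x, 'k) mlb) {w. w \<noteq> [] \<and> sorted (drop 2 w)}"
    using GS_basis_and_mlb_basis(2)[OF refl, where ?'x='x and ?'k='k] by (simp add: standard_words_def)
next
  assume n2: "CHAR('k) \<noteq> 2"
  show "GS_basis (S1 \<union> S2 :: ('x, 'k) lb set)"
    by (rule GS_basis_and_mlb_basis(1)) (simp add: n2)
  have sorted: "sorted (drop 2 w)" if "w \<in> standard_words TYPE('k)" for w :: "'x list"
    using that by (auto simp: standard_words_def standard_pair_def elim: sorted_wrt_mono_rel[rotated])
  have le: "w ! j \<le> w ! (j + 1)" if "sorted (drop 2 w)" "2 \<le> j" "j + 1 < length w"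
    for w :: "'x list" and j
    using sorted_nth_mono[OF that(1), of "j - 2" "j - 1"] that(2,3)
    by (auto simp: numeral_2_eq_2 Suc_diff_Suc)
  have "standard_words TYPE('k) = {w :: 'x list. w \<noteq> [] \<and> sorted (drop 2 w) \<and>
      (\<forall>j. 2 \<le> j \<and> j + 1 < length w \<and> par (w ! j) = 1 \<longrightarrow> w ! j \<noteq> w ! (j + 1))}"
  proof (intro set_eqI iffI CollectI conjI allI impI)
    fix w :: "'x list" and j
    assume w: "w \<in> standard_words TYPE('k)"
    then show "w \<noteq> []" "sorted (drop 2 w)" using sorted by (auto simp: standard_words_def)
    assume "2 \<le> j \<and> j + 1 < length w \<and> par (w ! j) = 1"
    with w show "w ! j \<noteq> w ! (j + 1)"
      unfolding standard_words_iff standard_pair_def twist_eq_0_iff using n2 by blast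
  next
    fix w :: "'x list"
    assume "w \<in> {w. w \<noteq> [] \<and> sorted (drop 2 w) \<and>
      (\<forall>j. 2 \<le> j \<and> j + 1 < length w \<and> par (w ! j) = 1 \<longrightarrow> w ! j \<noteq> w ! (j + 1))}"
    then show "w \<in> standard_words TYPE('k)"
      unfolding standard_words_iff standard_pair_def twist_eq_0_iff using le by auto
  qed
  then show "mlb.basis_family (mlb_word :: 'x list \<Rightarrow> ('x, 'k) mlb)
      {w. w \<noteq> [] \<and> sorted (drop 2 w) \<and>
        (\<forall>j. 2 \<le> j \<and> j + 1 < length w \<and> par (w ! j) = 1 \<longrightarrow> w ! j \<noteq> w ! (j + 1))}"
    using GS_basis_and_mlb_basis(2)[OF refl, where ?'x='x and ?'k='k] by simp
qed

end
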